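(* Let $G$ be a separable (more generally, $\omega$-bounded) topological group. The following conditions are equivalent. (1) $G$ is non-precompact. (2) $G$ admits a fixed point-free continuous action by affine isometries on the Holmes space $\langle\mathbb{U}\rangle$. (3) $G$ admits a strongly moving continuous action by isometries on the Holmes space $\langle\mathbb{U}\rangle$.
   Context: Topological groups are assumed Hausdorff. A topological group $G$ is precompact if for every neighbourhood $V$ of the identity there is a finite $F\subseteq G$ with $FV=G$; it is $\omega$-bounded if it can be covered by countably many translates of every non-empty open subset. The Urysohn space $\mathbb{U}$ is the unique (up to isometry) complete separable metric space that contains an isometric copy of every separable metric space and is ultrahomogeneous (every isometry between finite subspaces extends to an isometry of $\mathbb{U}$ onto itself). The Holmes space $\langle\mathbb{U}\rangle$ is the (unique up to linear isometry, by a theorem of Holmes) Banach space obtained as the closed linear span of the image of an isometric embedding of $\mathbb{U}$ into a real Banach space whose range contains $0$. It coincides with the Lipschitz-free Banach space $B(\mathbb{U},\ast)$: the completion of the real vector space $L(\mathbb U,\ast)$ having $\mathbb{U}\setminus\{\ast\}$ as Hamel basis and $\ast$ as zero, with the largest seminorm $p$ satisfying $p(x-y)\le d(x,y)$ for all $x,y\in\mathbb{U}$ (which is a norm). Actions by isometries are by surjective isometries; an action is continuous if $G\times E\to E$ is jointly continuous. An action of $G$ by isometries on a metric space $X$ is strongly moving if there is $\varepsilon_0>0$ such that for every finite $F\subseteq X$ there is $g\in G$ with $d_X(F,gF)\ge\varepsilon_0$, where $d_X(A,B)=\inf\{d_X(a,b):a\in A,b\in B\}$. *)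

theory Defs
  imports "HOL-Analysis.Analysis"
begin

definition isometric_embedding ::
    "'a set \<Rightarrow> ('a \<Rightarrow> 'a \<Rightarrow> real) \<Rightarrow> 'b set \<Rightarrow> ('b \<Rightarrow> 'b \<Rightarrow> real) \<Rightarrow> ('a \<Rightarrow> 'b) \<Rightarrow> bool"
  where "isometric_embedding A d B e f \<longleftrightarrow>
    f ` A \<subseteq> B \<and> (\<forall>x\<in>A. \<forall>y\<in>A. e (f x) (f y) = d x y)"

definition isometry_onto ::
    "'a set \<Rightarrow> ('a \<Rightarrow> 'a \<Rightarrow> real) \<Rightarrow> 'b set \<Rightarrow> ('b \<Rightarrow> 'b \<Rightarrow> real) \<Rightarrow> ('a \<Rightarrow> 'b) \<Rightarrow> bool"
  where "isometry_onto A d B e f \<longleftrightarrow> isometric_embedding A d B e f \<and> f ` A = B"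

(* A separable metric space has at most continuum many points, so up to isometry its carrier is
   a set of real numbers (with an arbitrary metric m, unrelated to the usual one). Quantifying
   over such M and m therefore covers all separable metric spaces: see urysohn_space_universal. *)
definition urysohn_space :: "'u set \<Rightarrow> ('u \<Rightarrow> 'u \<Rightarrow> real) \<Rightarrow> bool"
  where "urysohn_space U d \<longleftrightarrow>
    Metric_space U d \<and>
    Metric_space.mcomplete U d \<and>
    separable_space (Metric_space.mtopology U d) \<and>
    (\<forall>(M :: real set) m. Metric_space M m \<and> separable_space (Metric_space.mtopology M m) \<longrightarrow>
       (\<exists>f. isometric_embedding M m U d f)) \<and>
    (\<forall>A B f. finite A \<and> A \<subseteq> U \<and> B \<subseteq> U \<and> isometry_onto A d B d f \<longrightarrow>
       (\<exists>h. isometry_onto U d U d h \<and> (\<forall>x\<in>A. h x = f x)))"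

lemma urysohn_space_universal:
  assumes U: "urysohn_space U d"
    and M: "Metric_space (M :: 'a set) m"
    and sep: "separable_space (Metric_space.mtopology M m)"
  shows "\<exists>f. isometric_embedding M m U d f"
proof (cases "M = {}")
  case True
  then show ?thesis by (simp add: isometric_embedding_def)
next
  case False
  interpret Metric_space M m by (rule M)
  obtain C where C: "countable C" "C \<subseteq> M" "mtopology closure_of C = M"
    using sep unfolding separable_space_def by auto
  have dense: "\<exists>y\<in>C. m x y < r" if "x \<in> M" "r > 0" for x r
    using that C(3) unfolding metric_closure_of by (auto simp: in_mball)
  have "C \<noteq> {}" using False dense by (metis equals0D ex_in_conv zero_less_one)
  then obtain e :: "nat \<Rightarrow> 'a" where e: "range e = C"
    using C(1) uncountable_def by blast
  obtain k :: "nat set \<Rightarrow> real" where k: "inj k"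
    using nat_sets_eqpoll_reals unfolding eqpoll_def bij_betw_def by blast
  define h where "h x = k {prod_encode (n, j) | n j. m x (e n) < inverse (real (Suc j))}" for x
  have inj: "inj_on h M"
  proof (rule inj_onI, rule ccontr)
    fix x y assume xy: "x \<in> M" "y \<in> M" "h x = h y" "x \<noteq> y"
    then have "m x y / 2 > 0" by simp
    then obtain j where j: "inverse (real (Suc j)) < m x y / 2"
      using reals_Archimedean by blast
    obtain n where n: "m x (e n) < inverse (real (Suc j))"
      using dense[OF xy(1), of "inverse (real (Suc j))"] e by auto
    have "{prod_encode (n, j) | n j. m x (e n) < inverse (real (Suc j))}
        = {prod_encode (n, j) | n j. m y (e n) < inverse (real (Suc j))}"
      using xy(3) k unfolding h_def by (simp add: inj_eq)
    then have "prod_encode (n, j) \<in> {prod_encode (n, j) | n j. m y (e n) < inverse (real (Suc j))}"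
      using n by blast
    then have "m y (e n) < inverse (real (Suc j))" by auto
    moreover have "e n \<in> M" using e C(2) by auto
    ultimately show False
      using n j triangle[of x "e n" y] commute[of y "e n"] xy by simp
  qed
  define g where "g = inv_into M h"
  have gh [simp]: "g (h x) = x" if "x \<in> M" for x using inj that unfolding g_def by simp
  define m' where "m' a b = m (g a) (g b)" for a b
  have M': "Metric_space (h ` M) m'"
    by unfold_locales (auto simp: m'_def commute inj_on_eq_iff[OF inj] triangle)
  interpret M': Metric_space "h ` M" m' by (rule M')
  have "M'.mtopology closure_of (h ` C) = h ` M"
  proof
    show "M'.mtopology closure_of (h ` C) \<subseteq> h ` M"
      using closure_of_subset_topspace[of M'.mtopology] by simp
    show "h ` M \<subseteq> M'.mtopology closure_of (h ` C)"
    proof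
      fix a assume "a \<in> h ` M"
      then obtain x where x: "x \<in> M" "a = h x" by blast
      have "\<exists>y\<in>h ` C. y \<in> M'.mball a r" if r: "r > 0" for r
      proof -
        obtain y where "y \<in> C" "m x y < r" using dense[OF x(1) r] by blast
        then have "h y \<in> M'.mball a r" using x C(2) by (auto simp: m'_def M'.in_mball)
        with \<open>y \<in> C\<close> show ?thesis by blast
      qed
      then show "a \<in> M'.mtopology closure_of (h ` C)"
        unfolding M'.metric_closure_of using x by blast
    qed
  qed
  then have "separable_space M'.mtopology"
    unfolding separable_space_def using C(1,2) by (metis M'.topspace_mtopology countable_image image_mono)
  then obtain f where "isometric_embedding (h ` M) m' U d f"
    using U M' unfolding urysohn_space_def by blast
  then have "isometric_embedding M m U d (f \<circ> h)"
    unfolding isometric_embedding_def by (auto simp: m'_def)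
  then show ?thesis by blast
qed

(* The Banach space 'b, with the embedded copy \<iota> ` U of the Urysohn space. *)
definition holmes_space :: "'u set \<Rightarrow> ('u \<Rightarrow> 'u \<Rightarrow> real) \<Rightarrow> ('u \<Rightarrow> 'b::banach) \<Rightarrow> bool"
  where "holmes_space U d \<iota> \<longleftrightarrow>
    urysohn_space U d \<and>
    isometric_embedding U d UNIV dist \<iota> \<and>
    0 \<in> \<iota> ` U \<and>
    closure (span (\<iota> ` U)) = UNIV"

(* The class topological_group_add is the library's notion of a topological group; it is written
   additively, but commutativity is not assumed. It does not include the Hausdorff axiom. *)
definition precompact_group :: "'g::topological_group_add itself \<Rightarrow> bool"
  where "precompact_group _ \<longleftrightarrow>
    (\<forall>V :: 'g set. 0 \<in> interior V \<longrightarrow> (\<exists>F. finite F \<and> (\<Union>a\<in>F. (\<lambda>v. a + v) ` V) = UNIV))"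

definition omega_bounded_group :: "'g::topological_group_add itself \<Rightarrow> bool"
  where "omega_bounded_group _ \<longleftrightarrow>
    (\<forall>V :: 'g set. open V \<and> V \<noteq> {} \<longrightarrow>
       (\<exists>F. countable F \<and> (\<Union>a\<in>F. (\<lambda>v. a + v) ` V) = UNIV))"

definition continuous_isometric_action ::
    "('g::topological_group_add \<Rightarrow> 'x::metric_space \<Rightarrow> 'x) \<Rightarrow> bool"
  where "continuous_isometric_action \<phi> \<longleftrightarrow>
    (\<forall>x. \<phi> 0 x = x) \<and>
    (\<forall>g h x. \<phi> (g + h) x = \<phi> g (\<phi> h x)) \<and>
    (\<forall>g. isometry_onto UNIV dist UNIV dist (\<phi> g)) \<and>
    continuous_on UNIV (\<lambda>(g, x). \<phi> g x)"

definition affine_map :: "('a::real_vector \<Rightarrow> 'b::real_vector) \<Rightarrow> bool"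
  where "affine_map f \<longleftrightarrow> (\<exists>L b. linear L \<and> (\<forall>x. f x = L x + b))"

definition fixed_point_free :: "('g \<Rightarrow> 'x \<Rightarrow> 'x) \<Rightarrow> bool"
  where "fixed_point_free \<phi> \<longleftrightarrow> (\<nexists>x. \<forall>g. \<phi> g x = x)"

(* The empty F is left out because setdist {} {} = 0, whereas the infimum of the empty set in
   the definition of the distance of two sets is infinite. *)
definition strongly_moving :: "('g \<Rightarrow> 'x::metric_space \<Rightarrow> 'x) \<Rightarrow> bool"
  where "strongly_moving \<phi> \<longleftrightarrow>
    (\<exists>\<epsilon>>0. \<forall>F. finite F \<and> F \<noteq> {} \<longrightarrow> (\<exists>g. setdist F (\<phi> g ` F) \<ge> \<epsilon>))"

end

theory Submission
  imports Defs
begin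

text \<open>
  If \<open>G\<close> is precompact, all orbits of a continuous isometric action are totally bounded. Hence the
  action is not strongly moving, and on a Banach space, if it is affine, Kakutani's argument on the
  compact closed convex hull of an orbit gives a fixed point.

  Conversely, let \<open>G\<close> be \<open>\<omega>\<close>-bounded and not precompact. By Neumann's covering argument \<open>G\<close> is not of
  the form \<open>S V S\<close> with \<open>S\<close> finite, for a suitable neighbourhood \<open>V\<close> of the identity, so that \<open>G\<close> with
  a continuous left-invariant pseudometric is a strongly moving \<open>G\<close>-space. Attaching Katetov
  one-point extensions orbit by orbit keeps it strongly moving. A back-and-forth argument chooses
  these extensions such that a dense subset of the resulting \<open>G\<close>-space embeds isometrically onto a
  dense subset of the given Urysohn space, so \<open>G\<close> acts on a dense subset of the latter. By Holmes'
  theorem the norm of a combination of points of the Urysohn space with total mass zero depends on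
  their distances only. Hence the action extends to affine isometries of the Holmes space, and it
  stays strongly moving there: if \<open>g\<close> moves a finite set \<open>Y\<close> to distance \<open>\<epsilon>\<close> from itself, the
  \<open>1\<close>-Lipschitz function that is \<open>\<epsilon>\<close> on \<open>Y\<close> and \<open>0\<close> on \<open>g Y\<close> separates affine combinations of \<open>Y\<close> from
  their images.
\<close>

section \<open>Left-invariant pseudometrics and covering by translates\<close>

text \<open>Non-precompactness only denies finite covers by left translates \<open>a + V\<close>,
  whereas a strongly moving action needs one \<open>g\<close> outside all sets
  \<open>a + V - b\<close> with \<open>a\<close>, \<open>b\<close> in a given finite set. Such a set
  is a left translate of the conjugate \<open>b + V - b\<close>, and no single neighbourhood
  controls all conjugates of \<open>V\<close>. This is the obstacle that Neumann's argument removes.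
  The group need not be metrizable, so the construction starts from a continuous left-invariant
  pseudometric, and spaces are handled up to zero distances. New points are attached with finite
  support because this keeps the orbit maps continuous, which may fail for arbitrary Katetov
  functions. Whole orbits have to be attached at once, and the distances inside a new orbit must
  again be moved by the same \<epsilon>; taking them as supremum distances of the extended functions
  achieves this. The action must live on the given space, so its points prescribe the new orbits.
  One action serves for (2) and (3): it is affine, and a fixed point \<open>x\<close> would
  contradict that \<open>{x}\<close> is moved.\<close>

lemma sum_list_minus_rev:
  fixes ys :: "'g::group_add list"
  shows "sum_list (map uminus (rev ys)) = - sum_list ys"
  by (induction ys) (auto simp: minus_add)

text \<open>Three summands, because a word will be cut into a prefix, one letter and a suffix.
  Continuity of the triple sum at the origin gives the neighbourhoods, and intersecting with the
  reflected set makes the result symmetric. With one summand \<open>0\<close> this also bounds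
  differences \<open>v - v'\<close>.\<close>

lemma symmetric_nhd_triple:
  fixes V :: "'g::topological_group_add set"
  assumes "open V" "0 \<in> V"
  obtains W where "open W" "0 \<in> W" "\<And>x. x \<in> W \<Longrightarrow> - x \<in> W"
    "\<And>x y z. \<lbrakk>x \<in> W; y \<in> W; z \<in> W\<rbrakk> \<Longrightarrow> x + y + z \<in> V"
proof -
  have "((\<lambda>(x, y, z). x + y + z) \<longlongrightarrow> 0 + 0 + (0::'g)) (nhds (0, 0, 0))"
    unfolding case_prod_unfold nhds_prod
    by (intro tendsto_add filterlim_fst filterlim_compose[OF filterlim_fst filterlim_snd]
        filterlim_compose[OF filterlim_snd filterlim_snd])
  then have "\<forall>\<^sub>F p in nhds (0, 0, 0). (\<lambda>(x, y, z). x + y + z) p \<in> V"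
    using assms by (simp add: tendsto_def)
  then obtain P Q R where PQR: "eventually P (nhds (0::'g))" "eventually Q (nhds (0::'g))"
    "eventually R (nhds (0::'g))" "\<And>x y z. P x \<Longrightarrow> Q y \<Longrightarrow> R z \<Longrightarrow> x + y + z \<in> V"
    unfolding nhds_prod eventually_prod_filter by (auto; blast)
  have "eventually (\<lambda>x. P x \<and> Q x \<and> R x) (nhds 0)"
    using PQR by (auto intro: eventually_conj)
  then obtain S where S: "open S" "0 \<in> S" "\<And>x. x \<in> S \<Longrightarrow> P x \<and> Q x \<and> R x"
    unfolding eventually_nhds by blast
  have "open (uminus -` S)"
    using S(1) by (intro open_vimage) (auto intro: continuous_intros)
  then show ?thesis
    using S PQR(4) by (intro that[of "S \<inter> uminus -` S"]) auto
qed

text \<open>The Birkhoff--Kakutani construction: elements of \<open>W n - W (Suc n)\<close> get weight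
  \<open>(1/2) ^ (n+1)\<close>, and the length of \<open>x\<close> is the infimum of the weights of the words representing
  it. Cutting a word near the middle of its weight shows that a word of weight less than
  \<open>(1/2) ^ (n+1)\<close> represents an element of \<open>W n\<close>.\<close>

lemma Birkhoff_Kakutani_length:
  fixes V :: "'g::topological_group_add set"
  assumes "open V" "0 \<in> V"
  obtains len :: "'g \<Rightarrow> real" and \<epsilon> where "\<And>x. 0 \<le> len x" "len 0 = 0" "\<And>x. len (- x) = len x"
    "\<And>x y. len (x + y) \<le> len x + len y" "(len \<longlongrightarrow> 0) (nhds 0)" "\<epsilon> > 0" "\<And>x. len x < \<epsilon> \<Longrightarrow> x \<in> V"
proof -
  define good where "good W \<longleftrightarrow> open W \<and> 0 \<in> W \<and> (\<forall>x\<in>W. - x \<in> W)" for W :: "'g set"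
  define tri where "tri W' W \<longleftrightarrow> (\<forall>x\<in>W'. \<forall>y\<in>W'. \<forall>z\<in>W'. x + y + z \<in> W)" for W' W :: "'g set"
  have ex: "\<exists>W'. good W' \<and> tri W' W" if "open W" "0 \<in> W" for W
    using symmetric_nhd_triple[OF that] unfolding good_def tri_def by metis
  obtain W0 where W0: "good W0" "tri W0 V" using ex assms by blast
  have "W0 \<subseteq> V"
  proof
    fix x assume "x \<in> W0"
    then have "x + 0 + 0 \<in> V" using W0 unfolding good_def tri_def by blast
    then show "x \<in> V" by simp
  qed
  obtain W where W: "\<And>n. good (W n)" "\<And>n. tri (W (Suc n)) (W n)" "W 0 = W0"
  proof -
    have "\<exists>f. \<forall>n. (good (f n) \<and> (n = 0 \<longrightarrow> f n = W0)) \<and> tri (f (Suc n)) (f n)"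
      using W0 ex by (intro dependent_nat_choice) (auto simp: good_def)
    then show ?thesis using that by metis
  qed
  have W_Suc: "W (Suc n) \<subseteq> W n" for n
  proof
    fix x assume "x \<in> W (Suc n)"
    then have "x + 0 + 0 \<in> W n" using W(1)[of "Suc n"] W(2)[of n] unfolding good_def tri_def by blast
    then show "x \<in> W n" by simp
  qed
  have W_anti: "W m \<subseteq> W n" if "n \<le> m" for m n
    using that W_Suc by (metis lift_Suc_antimono_le)
  define N where "N x = (if \<forall>n. x \<in> W n then 0 else (1/2::real) ^ (LEAST n. x \<notin> W n))" for x
  have N_nonneg: "0 \<le> N x" for x by (simp add: N_def)
  have N_less: "x \<in> W n" if "N x < (1/2) ^ n" for x n
  proof (rule ccontr)
    assume x: "x \<notin> W n"
    then have "(LEAST n. x \<notin> W n) \<le> n" by (rule Least_le)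
    then have "(1/2::real) ^ n \<le> N x" using x unfolding N_def by (auto intro!: power_decreasing)
    then show False using that by simp
  qed
  have N_le: "N x \<le> (1/2) ^ n" if x: "x \<in> W n" for x n
  proof (cases "\<forall>n. x \<in> W n")
    case False
    define k where "k = (LEAST n. x \<notin> W n)"
    have "x \<notin> W k" using False unfolding k_def by (metis (mono_tags, lifting) LeastI)
    then have "n \<le> k" using W_anti[of k n] x by (cases "n \<le> k") auto
    then have "(1/2::real) ^ k \<le> (1/2) ^ n" by (auto intro!: power_decreasing)
    then show ?thesis using False unfolding N_def k_def by auto
  qed (simp add: N_def)
  have N_minus: "N (- x) = N x" for x
  proof -
    have "- x \<in> W n \<longleftrightarrow> x \<in> W n" for n using W(1)[of n] unfolding good_def by force
    then show ?thesis by (simp add: N_def)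
  qed
  define wt where "wt ys = sum_list (map N ys)" for ys
  have wt_nonneg: "0 \<le> wt ys" for ys
    unfolding wt_def by (intro sum_list_nonneg) (auto simp: N_nonneg)
  have wt_append: "wt (xs @ ys) = wt xs + wt ys" for xs ys by (simp add: wt_def)
  have key: "sum_list ys \<in> W n" if "wt ys < (1/2) ^ Suc n" for ys n
    using that
  proof (induction "length ys" arbitrary: ys n rule: less_induct)
    case less
    show ?case
    proof (cases "ys = []")
      case True
      then show ?thesis using W(1)[of n] by (simp add: good_def)
    next
      case False
      \<comment> \<open>\<open>j\<close> is the last position whose preceding prefix carries at most
        half of the weight. By maximality the suffix after letter \<open>j\<close> carries at most
        half as well, so the induction hypothesis puts both pieces into \<open>W (Suc n)\<close>.
        Letter \<open>j\<close> weighs less than \<open>(1/2) ^ Suc n\<close>, which puts it there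
        directly.\<close>
      define j where "j = (GREATEST j. j < length ys \<and> wt (take j ys) \<le> wt ys / 2)"
      have "\<exists>j. j < length ys \<and> wt (take j ys) \<le> wt ys / 2"
        using False wt_nonneg[of ys] by (intro exI[of _ 0]) (auto simp: wt_def)
      then have j: "j < length ys" "wt (take j ys) \<le> wt ys / 2"
        unfolding j_def by (metis (mono_tags, lifting) GreatestI_nat less_imp_le)+
      have j_max: "i \<le> j" if "i < length ys" "wt (take i ys) \<le> wt ys / 2" for i
        unfolding j_def using that by (intro Greatest_le_nat[where b = "length ys"]) auto
      have split: "ys = take j ys @ ys ! j # drop (Suc j) ys" using j(1) by (simp add: id_take_nth_drop)
      have wt_split: "wt ys = wt (take j ys) + N (ys ! j) + wt (drop (Suc j) ys)"
        by (subst split, subst wt_append) (simp add: wt_def)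
      have drop: "wt (drop (Suc j) ys) \<le> wt ys / 2"
      proof (cases "Suc j < length ys")
        case True
        have "wt ys = wt (take (Suc j) ys) + wt (drop (Suc j) ys)"
          by (metis append_take_drop_id wt_append)
        then show ?thesis using j_max[OF True] by fastforce
      next
        case False
        then show ?thesis using wt_nonneg[of ys] by (simp add: wt_def)
      qed
      have "sum_list (take j ys) \<in> W (Suc n)"
        using j less.prems by (intro less.hyps) auto
      moreover have "sum_list (drop (Suc j) ys) \<in> W (Suc n)"
        using j(1) drop less.prems by (intro less.hyps) auto
      moreover have "ys ! j \<in> W (Suc n)"
        using wt_split wt_nonneg[of "take j ys"] wt_nonneg[of "drop (Suc j) ys"] less.prems
        by (intro N_less) auto
      ultimately have "sum_list (take j ys) + ys ! j + sum_list (drop (Suc j) ys) \<in> W n"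
        using W(2)[of n] by (simp add: tri_def)
      moreover have "sum_list ys = sum_list (take j ys) + ys ! j + sum_list (drop (Suc j) ys)"
        by (subst split, subst sum_list_append) (simp add: add.assoc)
      ultimately show ?thesis by simp
    qed
  qed
  define len where "len x = Inf {wt ys | ys. sum_list ys = x}" for x
  have bdd: "bdd_below {wt ys | ys. sum_list ys = x}" for x
    using wt_nonneg by (intro bdd_belowI[of _ 0]) auto
  have ne: "{wt ys | ys. sum_list ys = x} \<noteq> {}" for x
    by (auto intro!: exI[of _ "[x]"])
  have le_wt: "len (sum_list ys) \<le> wt ys" for ys
    unfolding len_def using bdd by (intro cInf_lower) auto
  have less_wt: "\<exists>ys. sum_list ys = x \<and> wt ys < len x + r" if "r > 0" for x r
    using that cInf_less_iff[OF ne bdd, of x "len x + r"] unfolding len_def by auto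
  have nonneg: "0 \<le> len x" for x
    unfolding len_def using ne wt_nonneg by (intro cInf_greatest) auto
  have le_N: "len x \<le> N x" for x
    using le_wt[of "[x]"] by (simp add: wt_def)
  have add: "len (x + y) \<le> len x + len y" for x y
  proof (rule field_le_epsilon)
    fix r :: real assume "r > 0"
    then obtain xs ys where "sum_list xs = x" "wt xs < len x + r/2" "sum_list ys = y" "wt ys < len y + r/2"
      using less_wt[of "r/2"] by (metis half_gt_zero)
    then show "len (x + y) \<le> len x + len y + r"
      using le_wt[of "xs @ ys"] wt_append[of xs ys] by auto
  qed
  have minus_le: "len (- x) \<le> len x" for x
  proof (rule field_le_epsilon)
    fix r :: real assume "r > 0"
    then obtain xs where "sum_list xs = x" "wt xs < len x + r" using less_wt by blast
    moreover have "wt (map uminus (rev xs)) = wt xs"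
      unfolding wt_def by (induction xs) (auto simp: N_minus)
    ultimately show "len (- x) \<le> len x + r"
      using le_wt[of "map uminus (rev xs)"] by (simp only: sum_list_minus_rev)
  qed
  have lim: "(len \<longlongrightarrow> 0) (nhds 0)"
  proof (rule order_tendstoI)
    fix r :: real assume "r < 0"
    then show "\<forall>\<^sub>F x in nhds 0. r < len x" using nonneg by (intro always_eventually allI) (meson less_le_trans)
  next
    fix r :: real assume "0 < r"
    then obtain n where n: "(1/2) ^ n < r" using real_arch_pow_inv by fastforce
    have "\<forall>\<^sub>F x in nhds 0. x \<in> W n"
      using W(1)[of n] by (auto simp: good_def eventually_nhds)
    then show "\<forall>\<^sub>F x in nhds 0. len x < r"
      by eventually_elim (use N_le le_N n in \<open>meson le_less_trans\<close>)
  qed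
  show ?thesis
  \<comment> \<open>\<open>1/2\<close> is the bound \<open>(1/2) ^ Suc n\<close> of
    \<open>key\<close> at \<open>n = 0\<close>.\<close>
  proof (rule that[of len "1/2"])
    show "len 0 = 0" using le_wt[of "[]"] nonneg[of 0] by (simp add: wt_def)
    show "len (- x) = len x" for x using minus_le[of x] minus_le[of "- x"] by simp
    show "x \<in> V" if x: "len x < 1/2" for x
    proof -
      obtain ys where "sum_list ys = x" "wt ys < 1/2"
        using less_wt[of "1/2 - len x" x] x by auto
      then show ?thesis using key[of ys 0] W(3) \<open>W0 \<subseteq> V\<close> by auto
    qed
  qed (use nonneg add lim in auto)
qed

text \<open>B. H. Neumann's covering argument: if a translate of the last set avoids the given translates
  of it, that translate is covered by the other sets, and so the last set can be dropped.\<close>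

lemma Neumann_covering:
  fixes A :: "'i \<Rightarrow> 'g::group_add set"
  assumes "finite I" "\<forall>i\<in>I. finite (F i)" "\<forall>g. \<exists>i\<in>I. \<exists>f\<in>F i. \<exists>a\<in>A i. g = f + a"
  shows "\<exists>i\<in>I. \<exists>E. finite E \<and> (\<forall>g. \<exists>f\<in>E. \<exists>a\<in>A i. \<exists>b\<in>A i. g = f + a - b)"
  using assms
proof (induction I arbitrary: F rule: finite_induct)
  case (insert k I)
  show ?case
  proof (cases "\<forall>g. \<exists>f\<in>F k. \<exists>a\<in>A k. \<exists>b\<in>A k. g = f + a - b")
    case True
    then show ?thesis using insert.prems(1) by auto
  next
    case False
    then obtain g where g: "\<And>f a b. \<lbrakk>f \<in> F k; a \<in> A k; b \<in> A k\<rbrakk> \<Longrightarrow> g \<noteq> f + a - b" by blast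
    \<comment> \<open>By the choice of \<open>g\<close>, the set \<open>g + A k\<close> misses every
      \<open>p + A k\<close> with \<open>p\<close> in \<open>F k\<close>, so the sets
      \<open>q + A i\<close> with \<open>i\<close> in \<open>I\<close> cover it. Hence
      \<open>p + A k\<close>, which is \<open>p - g\<close> followed by \<open>g + A k\<close>, is
      covered by the sets \<open>p - g + q + A i\<close>.\<close>
    define F' where "F' i = F i \<union> (\<lambda>(p, q). p + (- g + q)) ` (F k \<times> F i)" for i
    have "\<exists>i\<in>I. \<exists>f\<in>F' i. \<exists>a\<in>A i. x = f + a" for x
    proof -
      obtain i f a where ifa: "i \<in> insert k I" "f \<in> F i" "a \<in> A i" "x = f + a"
        using insert.prems(2) by blast
      show ?thesis
      proof (cases "i \<in> I")
        case True
        then show ?thesis using ifa unfolding F'_def by blast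
      next
        case False
        then have ik: "i = k" using ifa by simp
        obtain i' f' a' where i': "i' \<in> insert k I" "f' \<in> F i'" "a' \<in> A i'" "g + a = f' + a'"
          using insert.prems(2) by meson
        have "i' \<noteq> k"
        proof
          assume "i' = k"
          then have "g \<noteq> f' + a' - a" using g i' ifa ik by blast
          then show False using i'(4) by (metis add_diff_cancel)
        qed
        then have "i' \<in> I" using i' by simp
        moreover have "x = (f + (- g + f')) + a'"
          using ifa(4) i'(4) by (metis add.assoc minus_add_cancel)
        moreover have "f + (- g + f') \<in> F' i'"
          using ifa ik i' unfolding F'_def by force
        ultimately show ?thesis using i' by blast
      qed
    qed
    moreover have "\<forall>i\<in>I. finite (F' i)" using insert.prems(1) by (auto simp: F'_def)
    ultimately show ?thesis using insert.IH[of F'] by blast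
  qed
qed simp

text \<open>If \<open>S\<close> were a counterexample, every \<open>g\<close> would lie in some
  \<open>a + V - b\<close>, that is in the translate by \<open>a - b\<close> of the conjugate
  \<open>b + V - b\<close>. Neumann's argument leaves one \<open>b\<close> such that finitely many
  translates of the difference set of this conjugate cover the group. Cancelling \<open>b\<close> on
  the right turns them into translates of \<open>V - V\<close>, which lies in the neighbourhood
  \<open>W\<close> witnessing non-precompactness.\<close>

lemma non_precompact_moves_finite:
  assumes "\<not> precompact_group TYPE('g::topological_group_add)"
  obtains V :: "'g::topological_group_add set" where "open V" "0 \<in> V"
    "\<And>S. finite S \<Longrightarrow> \<exists>g. \<forall>a\<in>S. \<forall>b\<in>S. - a + g + b \<notin> V"
proof -
  obtain W :: "'g set" where W: "0 \<in> interior W"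
    "\<And>F. finite F \<Longrightarrow> (\<Union>a\<in>F. (\<lambda>v. a + v) ` W) \<noteq> UNIV"
    using assms unfolding precompact_group_def not_all not_imp not_ex de_Morgan_conj by metis
  obtain V where V: "open V" "0 \<in> V" "\<And>x. x \<in> V \<Longrightarrow> - x \<in> V"
    "\<And>x y z. \<lbrakk>x \<in> V; y \<in> V; z \<in> V\<rbrakk> \<Longrightarrow> x + y + z \<in> interior W"
    using symmetric_nhd_triple[OF open_interior W(1)] by blast
  have "\<exists>g. \<forall>a\<in>S. \<forall>b\<in>S. - a + g + b \<notin> V" if S: "finite S" for S
  proof (rule ccontr)
    assume "\<not> ?thesis"
    then have *: "\<exists>a\<in>S. \<exists>b\<in>S. - a + g + b \<in> V" for g by blast
    have "\<forall>g. \<exists>b\<in>S. \<exists>f\<in>(\<lambda>a. a - b) ` S. \<exists>c\<in>(\<lambda>v. b + v - b) ` V. g = f + c"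
    proof
      fix g
      obtain a b where ab: "a \<in> S" "b \<in> S" "- a + g + b \<in> V" using * by blast
      have "g = (a - b) + (b + (- a + g + b) - b)"
        by (simp add: diff_conv_add_uminus add.assoc del: add_uminus_conv_diff)
      then show "\<exists>b\<in>S. \<exists>f\<in>(\<lambda>a. a - b) ` S. \<exists>c\<in>(\<lambda>v. b + v - b) ` V. g = f + c"
        using ab by blast
    qed
    then obtain b E where bE: "finite E" "\<And>g. \<exists>f\<in>E. \<exists>c\<in>(\<lambda>v. b + v - b) ` V. \<exists>c'\<in>(\<lambda>v. b + v - b) ` V. g = f + c - c'"
      using Neumann_covering[OF S, of "\<lambda>b. (\<lambda>a. a - b) ` S" "\<lambda>b. (\<lambda>v. b + v - b) ` V"] S by auto
    have "g \<in> (\<Union>a\<in>(\<lambda>f. f + b) ` E. (\<lambda>v. a + v) ` W)" for g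
    proof -
      obtain f v v' where f: "f \<in> E" "v \<in> V" "v' \<in> V" "g - b = f + (b + v - b) - (b + v' - b)"
        using bE(2)[of "g - b"] by blast
      have "g - b = f + b + (v - v') - b"
        using f(4) by (simp only: diff_conv_add_uminus minus_add minus_minus add.assoc minus_add_cancel)
      then have "g = f + b + (v - v')" by (metis diff_add_cancel)
      moreover have "v - v' \<in> W"
        using V(4)[OF f(2) V(3)[OF f(3)] V(2)] interior_subset by auto
      ultimately show ?thesis using f by blast
    qed
    then show False using W(2)[of "(\<lambda>f. f + b) ` E"] bE(1) by blast
  qed
  then show ?thesis using that V by blast
qed

section \<open>Metric spaces with a group action\<close>

text \<open>Metric \<open>G\<close>-spaces with countably many orbits are encoded as invariant pseudometrics on \<open>G \<times> nat\<close>: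
  the orbit of \<open>(0, i)\<close> is a copy of \<open>G\<close> in which points at distance zero are not identified.\<close>

definition shift :: "'g::group_add \<Rightarrow> 'g \<times> nat \<Rightarrow> 'g \<times> nat" where
  "shift g x = (g + fst x, snd x)"

lemma fst_shift [simp]: "fst (shift g x) = g + fst x"
  and snd_shift [simp]: "snd (shift g x) = snd x"
  and shift_shift: "shift g (shift h x) = shift (g + h) x"
  and shift_zero [simp]: "shift 0 x = x"
  by (simp_all add: shift_def add.assoc)

lemma shift_cancel [simp]: "shift g (shift (- g) x) = x" "shift (- g) (shift g x) = x"
  by (simp_all add: shift_shift)

definition pseudometric_on :: "'a set \<Rightarrow> ('a \<Rightarrow> 'a \<Rightarrow> real) \<Rightarrow> bool" where
  "pseudometric_on X D \<longleftrightarrow>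
    (\<forall>x\<in>X. D x x = 0) \<and> (\<forall>x\<in>X. \<forall>y\<in>X. D x y = D y x) \<and>
    (\<forall>x\<in>X. \<forall>y\<in>X. \<forall>z\<in>X. D x z \<le> D x y + D y z)"

lemma pseudometric_onD:
  assumes "pseudometric_on X D" "x \<in> X" "y \<in> X"
  shows "D x x = 0" "D x y = D y x" "0 \<le> D x y" "z \<in> X \<Longrightarrow> D x z \<le> D x y + D y z"
proof -
  show *: "D x x = 0" "D x y = D y x" and **: "z \<in> X \<Longrightarrow> D x z \<le> D x y + D y z" for z
    using assms by (simp_all add: pseudometric_on_def)
  show "0 \<le> D x y" using *(1,2) **[of x] assms(2) by simp
qed

text \<open>The possible distances from one further point to the points of \<open>A\<close>: the
  inequalities are its triangle inequalities. Nonnegativity is the case \<open>a = b\<close> of the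
  second one, where \<open>D\<close> vanishes on the diagonal.\<close>

definition Katetov_on :: "'a set \<Rightarrow> ('a \<Rightarrow> 'a \<Rightarrow> real) \<Rightarrow> ('a \<Rightarrow> real) \<Rightarrow> bool" where
  "Katetov_on A D f \<longleftrightarrow> (\<forall>a\<in>A. \<forall>b\<in>A. f a \<le> D a b + f b \<and> D a b \<le> f a + f b)"

lemma Katetov_onD:
  assumes "Katetov_on A D f" "a \<in> A" "b \<in> A"
  shows "f a \<le> D a b + f b" "D a b \<le> f a + f b"
  using assms by (simp_all add: Katetov_on_def)

lemma Katetov_on_nonneg:
  assumes "Katetov_on A D f" "pseudometric_on X D" "A \<subseteq> X" "a \<in> A"
  shows "0 \<le> f a"
  using Katetov_onD(2)[OF assms(1,4,4)] pseudometric_onD(1)[OF assms(2), of a] assms(3,4) by auto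

text \<open>The counterpart of \<open>strongly_moving\<close> for encoded spaces. The constant is a
  parameter because the same \<epsilon> has to survive infinitely many extensions.\<close>

definition moves_finite :: "('g::group_add \<times> nat) set \<Rightarrow> ('g \<times> nat \<Rightarrow> 'g \<times> nat \<Rightarrow> real) \<Rightarrow> real \<Rightarrow> bool" where
  "moves_finite X D \<epsilon> \<longleftrightarrow> (\<forall>Y\<subseteq>X. finite Y \<longrightarrow> (\<exists>g. \<forall>y\<in>Y. \<forall>y'\<in>Y. \<epsilon> \<le> D y (shift g y')))"

text \<open>Continuity is asked of the orbit maps at the identity only; since the action is
  isometric, joint continuity follows from this.\<close>

definition G_metric :: "('g::topological_group_add \<times> nat) set \<Rightarrow> ('g \<times> nat \<Rightarrow> 'g \<times> nat \<Rightarrow> real) \<Rightarrow> bool" where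
  "G_metric X D \<longleftrightarrow>
    pseudometric_on X D \<and> (\<forall>g. \<forall>x\<in>X. \<forall>y\<in>X. D (shift g x) (shift g y) = D x y) \<and>
    (\<forall>x\<in>X. ((\<lambda>g. D (shift g x) x) \<longlongrightarrow> 0) (nhds 0))"

abbreviation orbits :: "nat set \<Rightarrow> ('g \<times> nat) set" where
  "orbits I \<equiv> UNIV \<times> I"

text \<open>A new orbit is attached by identifying the point \<open>(g, Suc n)\<close> with the largest
  \<open>1\<close>-Lipschitz extension of \<open>f\<close> transported by \<open>g\<close>, and an old point with its distance
  function; the new pseudometric is the supremum distance of these functions.\<close>

lemma G_metric_add_orbit:
  fixes D :: "'g::topological_group_add \<times> nat \<Rightarrow> 'g \<times> nat \<Rightarrow> real"
  assumes D: "G_metric (orbits {..n}) D" and mv: "moves_finite (orbits {..n}) D \<epsilon>"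
    and A: "finite A" "A \<noteq> {}" "A \<subseteq> orbits {..n}" and f: "Katetov_on A D f"
  obtains D' where "G_metric (orbits {..Suc n}) D'" "moves_finite (orbits {..Suc n}) D' \<epsilon>"
    "\<And>x y. \<lbrakk>x \<in> orbits {..n}; y \<in> orbits {..n}\<rbrakk> \<Longrightarrow> D' x y = D x y"
    "\<And>a. a \<in> A \<Longrightarrow> D' (0, Suc n) a = f a"
proof -
  define X :: "('g \<times> nat) set" where "X = orbits {..n}"
  define X' :: "('g \<times> nat) set" where "X' = orbits {..Suc n}"
  have pm: "pseudometric_on X D" and inv: "\<And>g x y. \<lbrakk>x \<in> X; y \<in> X\<rbrakk> \<Longrightarrow> D (shift g x) (shift g y) = D x y"
    and cont: "\<And>x. x \<in> X \<Longrightarrow> ((\<lambda>g. D (shift g x) x) \<longlongrightarrow> 0) (nhds 0)"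
    using D by (auto simp: G_metric_def X_def)
  note pmD = pseudometric_onD[OF pm]
  have AX: "A \<subseteq> X" using A(3) by (simp add: X_def)
  have shX: "shift g x \<in> X \<longleftrightarrow> x \<in> X" for g x by (auto simp: X_def mem_Times_iff)
  have X'_cases: "p \<in> X \<or> snd p = Suc n" if "p \<in> X'" for p
    using that by (auto simp: X_def X'_def mem_Times_iff)
  have XX': "x \<in> X \<Longrightarrow> x \<in> X'" for x by (auto simp: X_def X'_def mem_Times_iff)
  define K where "K p x = (if snd p \<le> n then D p x
    else Min ((\<lambda>t. f t + D (shift (fst p) t) x) ` A))" for p x
  have K_old: "K p x = D p x" if "p \<in> X" for p x using that by (auto simp: K_def X_def mem_Times_iff)
  have K_le: "K p x \<le> f t + D (shift (fst p) t) x" if "snd p = Suc n" "t \<in> A" for p x t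
    using that A(1) by (simp add: K_def)
  have K_ex: "\<exists>t\<in>A. K p x = f t + D (shift (fst p) t) x" if "snd p = Suc n" for p x
  proof -
    have "K p x \<in> (\<lambda>t. f t + D (shift (fst p) t) x) ` A"
      using that A(1,2) Min_in[of "(\<lambda>t. f t + D (shift (fst p) t) x) ` A"] by (simp add: K_def)
    then show ?thesis by auto
  qed
  have f_nonneg: "0 \<le> f t" if "t \<in> A" for t using Katetov_on_nonneg[OF f pm AX that] .
  have kat: "Katetov_on X D (K p)" if p: "p \<in> X'" for p
    unfolding Katetov_on_def
  proof (intro ballI)
    fix x y assume xy: "x \<in> X" "y \<in> X"
    show "K p x \<le> D x y + K p y \<and> D x y \<le> K p x + K p y"
    proof (cases "p \<in> X")
      case True
      then show ?thesis using xy pmD(4)[of p y x] pmD(4)[of x p y] pmD(2)[of x y] pmD(2)[of x p]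
        by (simp add: K_old)
    next
      case False
      then have sp: "snd p = Suc n" using X'_cases p by blast
      obtain t where t: "t \<in> A" "K p x = f t + D (shift (fst p) t) x" using K_ex[OF sp] by blast
      obtain s where s: "s \<in> A" "K p y = f s + D (shift (fst p) s) y" using K_ex[OF sp] by blast
      have tX: "t \<in> X" "s \<in> X" "shift (fst p) t \<in> X" "shift (fst p) s \<in> X"
        using t(1) s(1) AX by (auto simp: shX)
      have "K p x \<le> f s + D (shift (fst p) s) x" using K_le[OF sp s(1)] .
      also have "\<dots> \<le> D x y + K p y"
        using s(2) pmD(4)[of "shift (fst p) s" y x] pmD(2)[of x y] tX xy by simp
      finally have 1: "K p x \<le> D x y + K p y" .
      have "D x y \<le> D x (shift (fst p) t) + D (shift (fst p) t) y"
        using tX xy pmD(4) by blast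
      also have "\<dots> \<le> D (shift (fst p) t) x + D (shift (fst p) t) (shift (fst p) s) + D (shift (fst p) s) y"
        using tX xy pmD(4)[of "shift (fst p) t" "shift (fst p) s" y] pmD(2)[of x "shift (fst p) t"] by simp
      also have "D (shift (fst p) t) (shift (fst p) s) \<le> f t + f s"
        using inv[OF tX(1,2)] Katetov_onD(2)[OF f t(1) s(1)] by simp
      finally show ?thesis using 1 t(2) s(2) by simp
    qed
  qed
  have K_shift: "K (shift g p) (shift g x) = K p x" if "x \<in> X" "p \<in> X'" for g p x
  proof (cases "p \<in> X")
    case True
    then show ?thesis using that inv[of p x g] by (simp add: K_old shX)
  next
    case False
    then have sp: "snd p = Suc n" using X'_cases that(2) by blast
    have "D (shift (g + fst p) t) (shift g x) = D (shift (fst p) t) x" if "t \<in> A" for t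
      using inv[of "shift (fst p) t" x g] that AX \<open>x \<in> X\<close> by (auto simp: shift_shift shX)
    then show ?thesis using sp by (simp add: K_def cong: image_cong_simp)
  qed
  obtain a0 where a0: "a0 \<in> A" "a0 \<in> X" using A(2) AX by blast
  define D' where "D' p q = (SUP x\<in>X. \<bar>K p x - K q x\<bar>)" for p q
  have abs_le: "\<bar>K p x - K q x\<bar> \<le> K p y + K q y" if "x \<in> X" "y \<in> X" "p \<in> X'" "q \<in> X'" for p q x y
    using Katetov_onD[OF kat[OF that(3)] that(1,2)] Katetov_onD[OF kat[OF that(4)] that(1,2)]
    by linarith
  have bdd: "bdd_above ((\<lambda>x. \<bar>K p x - K q x\<bar>) ` X)" if "p \<in> X'" "q \<in> X'" for p q
    using abs_le[OF _ a0(2) that] by (auto intro!: bdd_aboveI2)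
  have D'_ge: "\<bar>K p x - K q x\<bar> \<le> D' p q" if "p \<in> X'" "q \<in> X'" "x \<in> X" for p q x
    unfolding D'_def using bdd that by (intro cSUP_upper) auto
  have D'_le: "D' p q \<le> c" if "\<And>x. x \<in> X \<Longrightarrow> \<bar>K p x - K q x\<bar> \<le> c" for p q c
    unfolding D'_def using that a0(2) by (intro cSUP_least) auto
  have D'_sym: "D' p q = D' q p" for p q by (simp add: D'_def abs_minus_commute)
  \<comment> \<open>As in the Kuratowski embedding, the supremum is attained at
    \<open>x = p\<close>, where \<open>K p\<close> vanishes.\<close>
  have D'_old: "D' p q = K q p" if "p \<in> X" "q \<in> X'" for p q
  proof (rule antisym)
    show "D' p q \<le> K q p"
      using D'_le[of p q "K q p"] abs_le[OF _ that(1) XX'[OF that(1)] that(2)] pmD(1) that(1)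
      by (simp add: K_old)
    have "0 \<le> K q p" using Katetov_onD(2)[OF kat[OF that(2)] that(1,1)] pmD(1) that(1) by simp
    then show "K q p \<le> D' p q" using D'_ge[OF XX'[OF that(1)] that(2,1)] pmD(1) that(1) by (simp add: K_old)
  qed
  have D'D: "D' p q = D p q" if "p \<in> X" "q \<in> X" for p q
    using D'_old[OF that(1) XX'[OF that(2)]] K_old pmD(2) that by simp
  have pm': "pseudometric_on X' D'"
    unfolding pseudometric_on_def
  proof (intro conjI ballI)
    have "X \<noteq> {}" using a0(2) by blast
    then show "D' x x = 0" for x by (simp add: D'_def)
    show "D' x y = D' y x" for x y by (rule D'_sym)
    fix p q r assume pqr: "p \<in> X'" "q \<in> X'" "r \<in> X'"
    show "D' p r \<le> D' p q + D' q r"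
    proof (rule D'_le)
      fix x assume "x \<in> X"
      then show "\<bar>K p x - K r x\<bar> \<le> D' p q + D' q r"
        using D'_ge[OF pqr(1,2)] D'_ge[OF pqr(2,3)] by fastforce
    qed
  qed
  have shX': "shift g x \<in> X' \<longleftrightarrow> x \<in> X'" for g x by (auto simp: X'_def mem_Times_iff)
  have inv_le: "D' (shift g p) (shift g q) \<le> D' p q" if "p \<in> X'" "q \<in> X'" for g p q
  proof (rule D'_le)
    fix x assume "x \<in> X"
    then have x: "shift (- g) x \<in> X" by (simp add: shX)
    show "\<bar>K (shift g p) x - K (shift g q) x\<bar> \<le> D' p q"
      using D'_ge[OF that x] K_shift[OF x that(1), of g] K_shift[OF x that(2), of g] by simp
  qed
  have inv': "D' (shift g p) (shift g q) = D' p q" if "p \<in> X'" "q \<in> X'" for g p q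
    using inv_le[OF that, of g] inv_le[of "shift g p" "shift g q" "- g"] that by (simp add: shX')
  have cont': "((\<lambda>g. D' (shift g p) p) \<longlongrightarrow> 0) (nhds 0)" if p: "p \<in> X'" for p
  proof (cases "p \<in> X")
    case True
    then show ?thesis using cont[OF True] by (simp add: D'D shX)
  next
    case False
    then have sp: "snd p = Suc n" using X'_cases p by blast
    have gt: "shift (fst p) t \<in> X" if "t \<in> A" for t using that AX by (auto simp: shX)
    \<comment> \<open>Here the finite support pays off: moving \<open>p\<close> by \<open>g\<close>
      changes \<open>K p\<close> by at most the displacement of some transported support point, and
      the finite sum of all these displacements tends to \<open>0\<close>.\<close>
    have "D' (shift g p) p \<le> (\<Sum>t\<in>A. D (shift g (shift (fst p) t)) (shift (fst p) t))" (is "_ \<le> ?S g") for g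
    proof (rule D'_le)
      fix x assume x: "x \<in> X"
      have le: "D (shift g (shift (fst p) t)) (shift (fst p) t) \<le> ?S g" if "t \<in> A" for t
        using that A(1) gt pmD(3) by (intro member_le_sum) (auto simp: shX)
      obtain t where t: "t \<in> A" "K p x = f t + D (shift (fst p) t) x" using K_ex[OF sp] by blast
      obtain s where s: "s \<in> A" "K (shift g p) x = f s + D (shift g (shift (fst p) s)) x"
        using K_ex[of "shift g p" x] sp by (auto simp: shift_shift)
      have "K p x \<le> f s + D (shift (fst p) s) x" using K_le[OF sp s(1)] .
      also have "\<dots> \<le> K (shift g p) x + ?S g"
        using s(2) pmD(4)[of "shift (fst p) s" "shift g (shift (fst p) s)" x] gt[OF s(1)] x le[OF s(1)]
          pmD(2)[of "shift (fst p) s" "shift g (shift (fst p) s)"] by (simp add: shX)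
      finally have 1: "K p x \<le> K (shift g p) x + ?S g" .
      have "K (shift g p) x \<le> f t + D (shift g (shift (fst p) t)) x"
        using K_le[of "shift g p" t x] sp t(1) by (simp add: shift_shift)
      also have "\<dots> \<le> K p x + ?S g"
        using t(2) pmD(4)[of "shift g (shift (fst p) t)" "shift (fst p) t" x] gt[OF t(1)] x le[OF t(1)]
        by (simp add: shX)
      finally show "\<bar>K (shift g p) x - K p x\<bar> \<le> ?S g" using 1 by linarith
    qed
    then have le: "\<forall>\<^sub>F g in nhds 0. D' (shift g p) p \<le> ?S g" by simp
    have ge: "\<forall>\<^sub>F g in nhds 0. 0 \<le> D' (shift g p) p"
      using pseudometric_onD(3)[OF pm'] p by (simp add: shX')
    have "(?S \<longlongrightarrow> (\<Sum>t\<in>A. 0)) (nhds 0)"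
      using gt cont by (intro tendsto_sum) auto
    then have "(?S \<longlongrightarrow> 0) (nhds 0)" by simp
    then show ?thesis by (rule tendsto_sandwich[OF ge le tendsto_const])
  qed
  have mv': "moves_finite X' D' \<epsilon>"
    unfolding moves_finite_def
  proof (intro allI impI)
    fix Y :: "('g \<times> nat) set" assume Y: "Y \<subseteq> X'" "finite Y"
    \<comment> \<open>A new point is represented by its transported support, so that a
      \<open>g\<close> moving \<open>Z\<close> away from itself also controls the new points of
      \<open>Y\<close>.\<close>
    define Z where "Z = (Y \<inter> X) \<union> (\<lambda>(p, t). shift (fst p) t) ` (Y \<times> A)"
    have "finite Z" "Z \<subseteq> X" using Y(2) A(1) AX by (auto simp: Z_def shX)
    then obtain g where g: "\<And>y y'. \<lbrakk>y \<in> Z; y' \<in> Z\<rbrakk> \<Longrightarrow> \<epsilon> \<le> D y (shift g y')"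
      using mv unfolding moves_finite_def X_def by metis
    have ZY: "shift (fst p) t \<in> Z" if "p \<in> Y" "t \<in> A" for p t using that by (force simp: Z_def)
    have mixed: "\<epsilon> \<le> K p x" if "snd p = Suc n" "\<And>t. t \<in> A \<Longrightarrow> \<epsilon> \<le> D (shift (fst p) t) x" for p x
      using K_ex[OF that(1), of x] that(2) f_nonneg by fastforce
    show "\<exists>g. \<forall>y\<in>Y. \<forall>y'\<in>Y. \<epsilon> \<le> D' y (shift g y')"
    proof (intro exI[of _ g] ballI)
      fix y y' assume y: "y \<in> Y" "y' \<in> Y"
      have yX': "y \<in> X'" "y' \<in> X'" using y Y(1) by auto
      consider "y \<in> X" "y' \<in> X" | "y \<in> X" "snd y' = Suc n" | "snd y = Suc n" "y' \<in> X"
        | "snd y = Suc n" "snd y' = Suc n" using X'_cases yX' by blast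
      then show "\<epsilon> \<le> D' y (shift g y')"
      proof cases
        case 1
        then show ?thesis using g[of y y'] y by (simp add: D'D shX Z_def)
      next
        case 2
        have "\<epsilon> \<le> D (shift (fst (shift g y')) t) y" if "t \<in> A" for t
        proof -
          have "shift (fst y') t \<in> X" using that AX by (auto simp: shX)
          then show ?thesis
            using g[OF _ ZY[OF y(2) that], of y] y(1) 2(1) pmD(2)[of y "shift g (shift (fst y') t)"]
            by (simp add: Z_def shX shift_shift)
        qed
        then show ?thesis using mixed[of "shift g y'" y] 2 yX' by (simp add: D'_old shX')
      next
        case 3
        have "\<epsilon> \<le> D (shift (fst y) t) (shift g y')" if "t \<in> A" for t
          using g[OF ZY[OF y(1) that], of y'] y(2) 3 by (simp add: Z_def)
        then show ?thesis using mixed[of y "shift g y'"] 3 yX' D'_sym[of y] by (simp add: D'_old shX)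
      next
        case 4
        \<comment> \<open>Two new points are told apart at the support point \<open>x\<close> of
          \<open>y\<close> where \<open>f\<close> is least: \<open>K y x\<close> is at most
          \<open>m\<close>, while \<open>K (shift g y') x\<close> is a value of \<open>f\<close>,
          hence at least \<open>m\<close>, plus a distance of at least \<epsilon>.\<close>
        define m where "m = Min (f ` A)"
        have "m \<in> f ` A" unfolding m_def using A(1,2) by (intro Min_in) auto
        then obtain s where s: "s \<in> A" "f s = m" by blast
        have m_le: "m \<le> f t" if "t \<in> A" for t using that A(1) by (simp add: m_def)
        define x where "x = shift (fst y) s"
        have x: "x \<in> X" using s AX by (auto simp: x_def shX)
        have "K y x \<le> m" using K_le[OF 4(1) s(1), of x] s(2) pmD(1)[OF x x] by (simp add: x_def)
        moreover obtain t where t: "t \<in> A" "K (shift g y') x = f t + D (shift g (shift (fst y') t)) x"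
          using K_ex[of "shift g y'" x] 4(2) by (auto simp: shift_shift)
        moreover have "\<epsilon> \<le> D (shift g (shift (fst y') t)) x"
        proof -
          have "shift g (shift (fst y') t) \<in> X" using t(1) AX by (auto simp: shX)
          then show ?thesis
            using g[OF ZY[OF y(1) s(1)] ZY[OF y(2) t(1)]] x pmD(2) by (simp add: x_def)
        qed
        ultimately have "\<epsilon> \<le> \<bar>K y x - K (shift g y') x\<bar>" using m_le[of t] by linarith
        also have "\<dots> \<le> D' y (shift g y')" using yX' x by (intro D'_ge) (auto simp: shX')
        finally show ?thesis .
      qed
    qed
  qed
  have D'_new: "D' (0, Suc n) a = f a" if a: "a \<in> A" for a
  proof -
    have aX: "a \<in> X" using a AX by blast
    have "D' (0, Suc n) a = K (0, Suc n) a"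
      using D'_old[OF aX, of "(0, Suc n)"] D'_sym by (simp add: X'_def)
    also have "\<dots> = f a"
    proof (rule antisym)
      show "K (0, Suc n) a \<le> f a" using K_le[of "(0, Suc n)" a a] a pmD(1)[OF aX aX] by simp
      obtain t where "t \<in> A" "K (0, Suc n) a = f t + D t a" using K_ex[of "(0, Suc n)" a] by auto
      then show "f a \<le> K (0, Suc n) a"
        using Katetov_onD(1)[OF f a, of t] pmD(2)[of a t] aX AX by auto
    qed
    finally show ?thesis .
  qed
  show ?thesis
  proof (rule that[of D'])
    show "G_metric (orbits {..Suc n}) D'"
      using pm' inv' cont' by (auto simp: G_metric_def X'_def)
    show "moves_finite (orbits {..Suc n}) D' \<epsilon>" using mv' by (simp add: X'_def)
    show "D' x y = D x y" if "x \<in> orbits {..n}" "y \<in> orbits {..n}" for x y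
      using that D'D by (simp add: X_def)
  qed (rule D'_new)
qed

section \<open>Extension properties of the Urysohn space\<close>

text \<open>Urysohn's extension property. Together with completeness and a dense sequence it is the
  form in which the Urysohn space enters the later arguments. \<open>h\<close> may vanish somewhere;
  the point found then belongs to \<open>F\<close>.\<close>

definition one_point_extendable :: "'w::metric_space set \<Rightarrow> bool" where
  "one_point_extendable W \<longleftrightarrow>
    (\<forall>F h. finite F \<and> F \<subseteq> W \<and> Katetov_on F dist h \<longrightarrow> (\<exists>w\<in>W. \<forall>p\<in>F. dist w p = h p))"

lemma one_point_extendableD:
  assumes "one_point_extendable W" "finite F" "F \<subseteq> W" "Katetov_on F dist h"
  shows "\<exists>w\<in>W. \<forall>p\<in>F. dist w p = h p"
  using assms by (simp add: one_point_extendable_def)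

text \<open>If \<open>h\<close> has no zero, adjoining an abstract point \<open>None\<close> at
  distances \<open>h\<close> to \<open>F\<close> gives a finite metric space. Universality places a
  copy of it somewhere in \<open>U\<close>, and ultrahomogeneity moves the copy of \<open>F\<close>
  back to \<open>F\<close>, taking the extra point along.\<close>

lemma urysohn_space_one_point_extendable:
  fixes \<iota> :: "'u \<Rightarrow> 'w::metric_space"
  assumes U: "urysohn_space U d" and \<iota>: "isometric_embedding U d UNIV dist \<iota>" and ne: "U \<noteq> {}"
  shows "one_point_extendable (\<iota> ` U)"
  unfolding one_point_extendable_def
proof (intro allI impI, elim conjE)
  fix F h assume F: "finite F" "F \<subseteq> \<iota> ` U" and h: "Katetov_on F dist h"
  interpret Metric_space U d using U by (simp add: urysohn_space_def)
  have homog: "\<exists>H. isometry_onto U d U d H \<and> (\<forall>x\<in>A. H x = f x)"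
    if "finite A" "A \<subseteq> U" "B \<subseteq> U" "isometry_onto A d B d f" for A B f
    using U that unfolding urysohn_space_def by simp
  have dist_\<iota>: "dist (\<iota> x) (\<iota> y) = d x y" if "x \<in> U" "y \<in> U" for x y
    using \<iota> that by (simp add: isometric_embedding_def)
  have h_nonneg: "0 \<le> h p" if "p \<in> F" for p
    using Katetov_onD(2)[OF h that that] by simp
  show "\<exists>w\<in>\<iota> ` U. \<forall>p\<in>F. dist w p = h p"
  proof (cases "\<exists>p\<in>F. h p = 0")
    case True
    then obtain p where p: "p \<in> F" "h p = 0" by blast
    have "dist p q = h q" if "q \<in> F" for q
      using Katetov_onD(1)[OF h that p(1)] Katetov_onD(2)[OF h p(1) that] p(2)
      by (simp add: dist_commute)
    then show ?thesis using p F by blast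
  next
    case False
    then have h_pos: "0 < h p" if "p \<in> F" for p using h_nonneg[OF that] that by force
    \<comment> \<open>The absolute values change nothing on \<open>M\<close>; they are there because
      \<open>Metric_space\<close> demands nonnegativity outside the carrier as well.\<close>
    define m where "m a b = (case (a, b) of (None, None) \<Rightarrow> 0 | (None, Some q) \<Rightarrow> \<bar>h q\<bar>
      | (Some p, None) \<Rightarrow> \<bar>h p\<bar> | (Some p, Some q) \<Rightarrow> dist p q)" for a b
    define M where "M = insert None (Some ` F)"
    have m_simps [simp]: "m None None = 0" "m None (Some q) = \<bar>h q\<bar>" "m (Some p) None = \<bar>h p\<bar>"
      "m (Some p) (Some q) = dist p q" for p q by (simp_all add: m_def)
    interpret M: Metric_space M m
    proof
      show "0 \<le> m x y" for x y by (cases x; cases y) auto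
      show "m x y = m y x" for x y by (cases x; cases y) (auto simp: dist_commute)
      show "m x y = 0 \<longleftrightarrow> x = y" if "x \<in> M" "y \<in> M" for x y
      proof -
        have "h p \<noteq> 0" if "p \<in> F" for p using h_pos[OF that] by simp
        then show ?thesis using that by (cases x; cases y) (auto simp: M_def)
      qed
      show "m x z \<le> m x y + m y z" if "x \<in> M" "y \<in> M" "z \<in> M" for x y z
      proof -
        have "\<bar>h p\<bar> = h p" if "p \<in> F" for p using h_nonneg[OF that] by simp
        moreover have "h q \<le> h p + dist p q" "h q \<le> dist q p + h p" "dist p q \<le> h p + h q"
          if "p \<in> F" "q \<in> F" for p q
          using Katetov_onD[OF h that] Katetov_onD[OF h that(2,1)] by (auto simp: dist_commute)
        ultimately show ?thesis
          using that h_nonneg by (cases x; cases y; cases z) (auto simp: M_def dist_triangle)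
      qed
    qed
    have "finite M" using F(1) by (simp add: M_def)
    then have "separable_space M.mtopology"
      unfolding separable_space_def using closure_of_topspace[of M.mtopology]
      by (intro exI[of _ M]) (simp add: countable_finite)
    then obtain f where f: "isometric_embedding M m U d f"
      using urysohn_space_universal[OF U M.Metric_space_axioms] by blast
    have fU: "f x \<in> U" if "x \<in> M" for x using f that by (auto simp: isometric_embedding_def)
    have d_f: "d (f x) (f y) = m x y" if "x \<in> M" "y \<in> M" for x y
      using f that by (auto simp: isometric_embedding_def)
    \<comment> \<open>The partial isometry to be extended: it sends the copy
      \<open>f (Some p)\<close> to the point of \<open>U\<close> that \<iota> maps to
      \<open>p\<close>.\<close>
    define \<psi> where "\<psi> x = inv_into U \<iota> (the (inv_into M f x))" for x
    have "inj_on f M"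
    proof (rule inj_onI)
      fix x y assume xy: "x \<in> M" "y \<in> M" "f x = f y"
      then have "m x y = 0" using d_f[of x y] fU[of y] by simp
      then show "x = y" using xy by simp
    qed
    then have \<psi>: "\<psi> (f (Some p)) = inv_into U \<iota> p" if "p \<in> F" for p
      using that by (simp add: \<psi>_def M_def inv_into_f_f)
    have inv: "inv_into U \<iota> p \<in> U" "\<iota> (inv_into U \<iota> p) = p" if "p \<in> F" for p
      using that F(2) by (auto intro: inv_into_into f_inv_into_f)
    define A where "A = f ` Some ` F"
    have SM: "Some p \<in> M" if "p \<in> F" for p using that by (simp add: M_def)
    have "isometry_onto A d (\<psi> ` A) d \<psi>"
      unfolding isometry_onto_def isometric_embedding_def
    proof (intro conjI ballI)
      fix x y assume "x \<in> A" "y \<in> A"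
      then obtain p q where "p \<in> F" "q \<in> F" "x = f (Some p)" "y = f (Some q)"
        unfolding A_def by blast
      then show "d (\<psi> x) (\<psi> y) = d x y"
        using dist_\<iota>[of "inv_into U \<iota> p" "inv_into U \<iota> q"] inv by (simp add: \<psi> d_f SM)
    qed auto
    moreover have "finite A" "A \<subseteq> U" "\<psi> ` A \<subseteq> U" using F fU SM \<psi> inv by (auto simp: A_def)
    ultimately obtain H where H: "isometry_onto U d U d H" "\<And>x. x \<in> A \<Longrightarrow> H x = \<psi> x"
      using homog[of A "\<psi> ` A" \<psi>] by blast
    have None: "None \<in> M" by (simp add: M_def)
    have HU: "H (f None) \<in> U" using H(1) fU[OF None] unfolding isometry_onto_def by blast
    have "dist (\<iota> (H (f None))) p = h p" if p: "p \<in> F" for p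
    proof -
      have "H (f (Some p)) = inv_into U \<iota> p" using H(2) \<psi>[OF p] p by (auto simp: A_def)
      then have "dist (\<iota> (H (f None))) p = d (H (f None)) (H (f (Some p)))"
        using dist_\<iota>[OF HU inv(1)[OF p]] inv(2)[OF p] by simp
      also have "\<dots> = d (f None) (f (Some p))"
        using H(1) fU[OF None] fU[OF SM[OF p]] by (simp add: isometry_onto_def isometric_embedding_def)
      also have "\<dots> = h p" using d_f[OF None SM[OF p]] h_nonneg[OF p] by simp
      finally show ?thesis .
    qed
    then show ?thesis using HU by blast
  qed
qed

lemma urysohn_space_complete:
  fixes \<iota> :: "'u \<Rightarrow> 'w::metric_space"
  assumes U: "urysohn_space U d" and \<iota>: "isometric_embedding U d UNIV dist \<iota>"
  shows "complete (\<iota> ` U)"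
  unfolding complete_def
proof (intro allI impI, elim conjE)
  fix w assume w: "\<forall>n. w n \<in> \<iota> ` U" "Cauchy w"
  interpret Metric_space U d using U by (simp add: urysohn_space_def)
  define s where "s n = inv_into U \<iota> (w n)" for n
  have s: "s n \<in> U" "w n = \<iota> (s n)" for n
    using w(1) by (auto simp: s_def intro: inv_into_into f_inv_into_f[symmetric])
  have dist_\<iota>: "dist (\<iota> x) (\<iota> y) = d x y" if "x \<in> U" "y \<in> U" for x y
    using \<iota> that by (simp add: isometric_embedding_def)
  have "MCauchy s"
    unfolding MCauchy_def using w(2) s(1) unfolding Cauchy_def s(2) by (auto simp: dist_\<iota>)
  moreover have mcomplete using U by (simp add: urysohn_space_def)
  ultimately obtain x where x: "limitin mtopology s x sequentially"
    unfolding mcomplete_def by blast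
  then have "x \<in> U" by (simp add: limitin_metric)
  have "w \<longlonglongrightarrow> \<iota> x"
    unfolding tendsto_iff
  proof (intro allI impI)
    fix e :: real assume "e > 0"
    then have "\<forall>\<^sub>F n in sequentially. s n \<in> U \<and> d (s n) x < e" using x by (simp add: limitin_metric)
    then show "\<forall>\<^sub>F n in sequentially. dist (w n) (\<iota> x) < e"
      by eventually_elim (simp add: s dist_\<iota> \<open>x \<in> U\<close>)
  qed
  then show "\<exists>l\<in>\<iota> ` U. w \<longlonglongrightarrow> l" using \<open>x \<in> U\<close> by blast
qed

lemma urysohn_space_dense_sequence:
  fixes \<iota> :: "'u \<Rightarrow> 'w::metric_space"
  assumes U: "urysohn_space U d" and \<iota>: "isometric_embedding U d UNIV dist \<iota>" and ne: "U \<noteq> {}"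
  obtains u :: "nat \<Rightarrow> 'w" where "range u \<subseteq> \<iota> ` U" "\<iota> ` U \<subseteq> closure (range u)"
proof -
  interpret Metric_space U d using U by (simp add: urysohn_space_def)
  obtain C where C: "countable C" "C \<subseteq> U" "mtopology closure_of C = U"
    using U unfolding urysohn_space_def separable_space_def by auto
  have dense: "\<exists>y\<in>C. d x y < r" if "x \<in> U" "r > 0" for x r
    using that C(3) unfolding metric_closure_of by (auto simp: in_mball)
  have "C \<noteq> {}" using ne dense by (metis equals0D ex_in_conv zero_less_one)
  then obtain e :: "nat \<Rightarrow> 'u" where e: "range e = C"
    using C(1) uncountable_def by blast
  show ?thesis
  proof (rule that[of "\<iota> \<circ> e"])
    show "range (\<iota> \<circ> e) \<subseteq> \<iota> ` U" using e C(2) by auto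
    show "\<iota> ` U \<subseteq> closure (range (\<iota> \<circ> e))"
    proof (clarsimp simp: closure_approachable)
      fix x and r :: real assume "x \<in> U" "0 < r"
      then obtain n where n: "d x (e n) < r" using dense e by blast
      have "e n \<in> U" using e C(2) by auto
      then have "dist (\<iota> (e n)) (\<iota> x) < r"
        using \<iota> n \<open>x \<in> U\<close> commute[of x] by (auto simp: isometric_embedding_def)
      then show "\<exists>n. dist (\<iota> (e n)) (\<iota> x) < r" by blast
    qed
  qed
qed

text \<open>\<open>D\<close> will be a pseudometric, so \<open>j\<close> may identify points at
  distance zero.\<close>

definition isometric_into :: "'a set \<Rightarrow> ('a \<Rightarrow> 'a \<Rightarrow> real) \<Rightarrow> 'w::metric_space set \<Rightarrow> ('a \<Rightarrow> 'w) \<Rightarrow> bool" where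
  "isometric_into A D W j \<longleftrightarrow> j ` A \<subseteq> W \<and> (\<forall>a\<in>A. \<forall>b\<in>A. dist (j a) (j b) = D a b)"

text \<open>The points of \<open>B\<close> are added one at a time: the distances from
  \<open>x\<close> to the points treated so far, transported by the map, form a Katetov function on
  the image. It is well defined although the map may identify points, since points with equal images
  have distance zero and so equal distances to \<open>x\<close>.\<close>

lemma partial_isometry_extend:
  assumes pm: "pseudometric_on X D" and W: "one_point_extendable W"
    and A: "finite A" "A \<subseteq> X" "isometric_into A D W j" and B: "finite B" "B \<subseteq> X"
  obtains j' where "\<And>a. a \<in> A \<Longrightarrow> j' a = j a" "isometric_into (A \<union> B) D W j'"
proof -
  have "\<exists>j'. (\<forall>a\<in>A. j' a = j a) \<and> isometric_into (A \<union> B) D W j'"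
    using B
  proof (induction B rule: finite_induct)
    case empty
    then show ?case using A by auto
  next
    case (insert x B)
    then obtain k where k: "\<forall>a\<in>A. k a = j a" "isometric_into (A \<union> B) D W k" by auto
    show ?case
    proof (cases "x \<in> A \<union> B")
      case True
      then show ?thesis using k by (metis Un_insert_right insert_absorb)
    next
      case False
      define C where "C = A \<union> B"
      have C: "finite C" "C \<subseteq> X" "x \<in> X" using A insert by (auto simp: C_def)
      have k_dist: "dist (k a) (k b) = D a b" if "a \<in> C" "b \<in> C" for a b
        using k(2) that by (simp add: isometric_into_def C_def)
      define h where "h p = D x (inv_into C k p)" for p
      have h: "h (k a) = D x a" if "a \<in> C" for a
      proof -
        define b where "b = inv_into C k (k a)"
        have b: "b \<in> C" "k b = k a" using that by (auto simp: b_def intro: inv_into_into f_inv_into_f)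
        then have "D a b = 0" "D b a = 0" using k_dist[of a b] k_dist[of b a] that by auto
        then have "D x b = D x a"
          using pseudometric_onD(4)[OF pm, of x a b] pseudometric_onD(4)[OF pm, of x b a] b C that
          by fastforce
        then show ?thesis by (simp add: h_def b_def)
      qed
      have "Katetov_on (k ` C) dist h"
        unfolding Katetov_on_def
      proof clarify
        fix a b assume ab: "a \<in> C" "b \<in> C"
        then have "a \<in> X" "b \<in> X" using C by auto
        then show "h (k a) \<le> dist (k a) (k b) + h (k b) \<and> dist (k a) (k b) \<le> h (k a) + h (k b)"
          using pseudometric_onD(4)[OF pm, of x b a] pseudometric_onD(4)[OF pm, of a x b]
            pseudometric_onD(2)[OF pm, of a b] pseudometric_onD(2)[OF pm, of a x] C(3)
          by (simp add: h k_dist ab)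
      qed
      moreover have "finite (k ` C)" "k ` C \<subseteq> W"
        using C(1) k(2) by (simp_all add: isometric_into_def C_def)
      ultimately have "\<exists>w\<in>W. \<forall>p\<in>k ` C. dist w p = h p"
        by (intro one_point_extendableD[OF W])
      then obtain w where w: "w \<in> W" "\<And>a. a \<in> C \<Longrightarrow> dist w (k a) = D x a" by (auto simp: h)
      define k' where "k' = k(x := w)"
      have k': "k' a = k a" if "a \<in> C" for a using that False by (auto simp: k'_def C_def)
      have "isometric_into (A \<union> insert x B) D W k'"
        unfolding isometric_into_def
      proof (intro conjI ballI subsetI)
        fix p assume "p \<in> k' ` (A \<union> insert x B)"
        then show "p \<in> W" using k(2) w(1) k' by (auto simp: isometric_into_def C_def k'_def)
      next
        fix a b assume "a \<in> A \<union> insert x B" "b \<in> A \<union> insert x B"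
        then consider "a = x" "b = x" | "a = x" "b \<in> C" | "a \<in> C" "b = x" | "a \<in> C" "b \<in> C"
          by (auto simp: C_def)
        then show "dist (k' a) (k' b) = D a b"
        proof cases
          case 1
          then show ?thesis using pseudometric_onD(1)[OF pm C(3,3)] by simp
        next
          case 2
          then show ?thesis using w(2)[of b] k'[of b] by (simp add: k'_def)
        next
          case 3
          then show ?thesis
            using w(2)[of a] k'[of a] pseudometric_onD(2)[OF pm C(3), of a] C(2)
            by (auto simp: k'_def dist_commute)
        next
          case 4
          then show ?thesis using k' k_dist by simp
        qed
      qed
      moreover have "\<forall>a\<in>A. k' a = j a" using k(1) k' by (auto simp: C_def)
      ultimately show ?thesis by blast
    qed
  qed
  then show ?thesis using that by blast
qed

section \<open>The back-and-forth construction\<close>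

text \<open>Here \<omega>-boundedness enters: for each \<open>n\<close>, countably many translates
  of the neighbourhood of identity elements moving \<open>(0, k)\<close> by less than
  \<open>inverse (real (Suc n))\<close> cover the group, and left invariance turns the translation
  elements into a net of the orbit.\<close>

lemma countable_dense_in_orbit:
  fixes D :: "'g::topological_group_add \<times> nat \<Rightarrow> 'g \<times> nat \<Rightarrow> real"
  assumes G: "omega_bounded_group TYPE('g)" and D: "G_metric (orbits I) D" and k: "k \<in> I"
  shows "\<exists>e :: nat \<Rightarrow> 'g. \<forall>g. \<forall>r>0. \<exists>m. D (e m, k) (g, k) < r"
proof -
  have pm: "pseudometric_on (orbits I) D"
    and inv: "D (shift g (a, k)) (shift g (b, k)) = D (a, k) (b, k)" for g a b
    using D k by (auto simp: G_metric_def)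
  have lim: "((\<lambda>g. D (shift g (0, k)) (0, k)) \<longlongrightarrow> 0) (nhds 0)"
    using D k by (auto simp: G_metric_def)
  have "\<exists>F. countable F \<and> (\<forall>g. \<exists>a\<in>F. D (a, k) (g, k) < inverse (real (Suc n)))" for n
  proof -
    have "\<forall>\<^sub>F g in nhds 0. D (shift g (0, k)) (0, k) < inverse (real (Suc n))"
      using lim by (rule order_tendstoD) simp
    then obtain V where V: "open V" "0 \<in> V" "\<And>g. g \<in> V \<Longrightarrow> D (g, k) (0, k) < inverse (real (Suc n))"
      unfolding eventually_nhds by (auto simp: shift_def)
    from V(1,2) have "open V \<and> V \<noteq> {}" by blast
    from G[unfolded omega_bounded_group_def, rule_format, OF this]
    obtain F where F: "countable F" "(\<Union>a\<in>F. (\<lambda>v. a + v) ` V) = UNIV" by blast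
    have "\<exists>a\<in>F. D (a, k) (g, k) < inverse (real (Suc n))" for g
    proof -
      have "g \<in> (\<Union>a\<in>F. (\<lambda>v. a + v) ` V)" using F(2) by simp
      then obtain a v where av: "a \<in> F" "v \<in> V" "g = a + v" by blast
      have "D (a, k) (g, k) = D (g, k) (a, k)" using pm k by (intro pseudometric_onD(2)) auto
      also have "\<dots> = D (v, k) (0, k)" using inv[of a v 0] av(3) by (simp add: shift_def)
      also have "\<dots> < inverse (real (Suc n))" by (rule V(3)[OF av(2)])
      finally show ?thesis using av(1) by (rule bexI)
    qed
    then show ?thesis using F(1) by blast
  qed
  then obtain F where F: "\<And>n. countable (F n)" "\<And>n g. \<exists>a\<in>F n. D (a, k) (g, k) < inverse (real (Suc n))"
    by metis
  define C where "C = (\<Union>n. F n)"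
  have "countable C" using F(1) by (simp add: C_def)
  moreover have "C \<noteq> {}" using F(2) by (force simp: C_def)
  ultimately have e: "range (from_nat_into C) = C" by (rule range_from_nat_into[rotated])
  show ?thesis
  proof (intro exI[of _ "from_nat_into C"] allI impI)
    fix g and r :: real assume "r > 0"
    then obtain n where "inverse (real (Suc n)) < r" using reals_Archimedean by blast
    moreover obtain a where a: "a \<in> F n" "D (a, k) (g, k) < inverse (real (Suc n))" using F(2) by blast
    moreover have "a \<in> range (from_nat_into C)" using a(1) e by (auto simp: C_def)
    ultimately show "\<exists>m. D (from_nat_into C m, k) (g, k) < r" by (auto intro: less_trans)
  qed
qed

text \<open>The pseudometric is the length of \<open>- x + y\<close>. An element
  \<open>- a + g + b\<close> outside \<open>V\<close> has length at least \<epsilon>, and this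
  length is the distance from \<open>a\<close> to \<open>g + b\<close>.\<close>

lemma ex_initial_G_metric:
  assumes "\<not> precompact_group TYPE('g::topological_group_add)"
  obtains D :: "'g::topological_group_add \<times> nat \<Rightarrow> 'g \<times> nat \<Rightarrow> real" and \<epsilon>
  where "G_metric (orbits {..0}) D" "\<epsilon> > 0" "moves_finite (orbits {..0}) D \<epsilon>"
proof -
  obtain V :: "'g set" where V: "open V" "0 \<in> V"
    "\<And>S. finite S \<Longrightarrow> \<exists>g. \<forall>a\<in>S. \<forall>b\<in>S. - a + g + b \<notin> V"
    by (rule non_precompact_moves_finite[OF assms], rule that)
  obtain len :: "'g \<Rightarrow> real" and \<epsilon> where len: "\<And>x. 0 \<le> len x" "len 0 = 0" "\<And>x. len (- x) = len x"
    "\<And>x y. len (x + y) \<le> len x + len y" "(len \<longlongrightarrow> 0) (nhds 0)" "\<epsilon> > 0" "\<And>x. len x < \<epsilon> \<Longrightarrow> x \<in> V"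
    by (rule Birkhoff_Kakutani_length[OF V(1,2)], rule that)
  define D where "D x y = len (- fst x + fst y)" for x y :: "'g \<times> nat"
  have "G_metric (orbits {..0}) D"
    unfolding G_metric_def pseudometric_on_def
  proof (intro conjI ballI allI)
    fix x y z :: "'g \<times> nat" and g
    show "D x x = 0" by (simp add: D_def len(2))
    show "D x y = D y x" using len(3)[of "- fst x + fst y"] by (simp add: D_def minus_add)
    show "D x z \<le> D x y + D y z"
      using len(4)[of "- fst x + fst y" "- fst y + fst z"] by (simp add: D_def add.assoc)
    show "D (shift g x) (shift g y) = D x y" by (simp add: D_def minus_add add.assoc del: add_uminus_conv_diff)
    have "((\<lambda>g. - (g + fst x) + fst x) \<longlongrightarrow> - (0 + fst x) + fst x) (nhds 0)"
      by (intro tendsto_intros filterlim_ident)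
    then have "((\<lambda>g. - (g + fst x) + fst x) \<longlongrightarrow> 0) (nhds 0)" by simp
    then show "((\<lambda>g. D (shift g x) x) \<longlongrightarrow> 0) (nhds 0)"
      unfolding D_def fst_shift by (rule filterlim_compose[OF len(5)])
  qed
  moreover have "moves_finite (orbits {..0}) D \<epsilon>"
    unfolding moves_finite_def
  proof (intro allI impI)
    fix Y :: "('g \<times> nat) set" assume "finite Y"
    then obtain g where g: "\<And>a b. \<lbrakk>a \<in> fst ` Y; b \<in> fst ` Y\<rbrakk> \<Longrightarrow> - a + g + b \<notin> V"
      using V(3)[of "fst ` Y"] by blast
    have "\<epsilon> \<le> len (- fst y + (g + fst y'))" if "y \<in> Y" "y' \<in> Y" for y y'
      using g[of "fst y" "fst y'"] len(7)[of "- fst y + (g + fst y')"] that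
      by (force simp: add.assoc not_less[symmetric])
    then show "\<exists>g. \<forall>y\<in>Y. \<forall>y'\<in>Y. \<epsilon> \<le> D y (shift g y')"
      by (intro exI[of _ g]) (simp add: D_def)
  qed
  ultimately show ?thesis using that len(6) by blast
qed

text \<open>The back-and-forth construction. A stage consists of the metric \<open>D\<close> on the first orbits,
  a finite set \<open>A\<close> isometrically mapped into \<open>W\<close> by \<open>j\<close>, and dense sequences \<open>e k\<close> of the orbits.
  Going back, the next point of the dense sequence \<open>u\<close> is hit by a new orbit; going forth, the
  map is extended to more points of the sequences \<open>e k\<close>.\<close>

definition stage where
  "stage W \<epsilon> n = (\<lambda>(D, A, j, e :: nat \<Rightarrow> nat \<Rightarrow> 'g::topological_group_add).
    G_metric (orbits {..n}) D \<and> moves_finite (orbits {..n}) D \<epsilon> \<and>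
    finite A \<and> A \<noteq> {} \<and> A \<subseteq> orbits {..n} \<and> isometric_into A D W j \<and>
    (\<forall>k\<le>n. \<forall>g. \<forall>r>0. \<exists>m. D (e k m, k) (g, k) < r))"

text \<open>The last condition is a bookkeeping device: each step matches a finite square of
  indices, so that in the limit every entry of every dense sequence is matched. Only the sequences
  \<open>e k\<close> with \<open>k \<le> n\<close> are binding at stage \<open>n\<close>.\<close>

definition stage_step where
  "stage_step u n = (\<lambda>(D, A, j, e) (D', A', j', e').
    (\<forall>x\<in>orbits {..n}. \<forall>y\<in>orbits {..n}. D' x y = D x y) \<and> A \<subseteq> A' \<and> (\<forall>a\<in>A. j' a = j a) \<and>
    (\<forall>k\<le>n. e' k = e k) \<and> u n \<in> j' ` A' \<and> (\<forall>k\<le>n. \<forall>m\<le>n. (e' k m, k) \<in> A'))"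

lemma stage_extend:
  fixes e :: "nat \<Rightarrow> nat \<Rightarrow> 'g::topological_group_add"
  assumes G: "omega_bounded_group TYPE('g)" and W: "one_point_extendable W" and u: "u n \<in> W"
    and st: "stage W \<epsilon> n (D, A, j, e)"
  shows "\<exists>s'. stage W \<epsilon> (Suc n) s' \<and> stage_step u n (D, A, j, e) s'"
proof -
  have D: "G_metric (orbits {..n}) D" "moves_finite (orbits {..n}) D \<epsilon>"
    and A: "finite A" "A \<noteq> {}" "A \<subseteq> orbits {..n}" and j: "isometric_into A D W j"
    and e: "\<And>k g r. \<lbrakk>k \<le> n; r > 0\<rbrakk> \<Longrightarrow> \<exists>m. D (e k m, k) (g, k) < r"
    using st by (auto simp: stage_def)
  \<comment> \<open>The target point \<open>u n\<close> prescribes the new orbit through its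
    distances to the points already matched; \<open>(0, Suc n)\<close> can then be sent to
    \<open>u n\<close>.\<close>
  define f where "f a = dist (u n) (j a)" for a
  have "f a \<le> dist (j a) (j b) + f b" "dist (j a) (j b) \<le> f a + f b" for a b
    unfolding f_def by metric+
  then have K: "Katetov_on A D f"
    using j unfolding Katetov_on_def isometric_into_def by metis
  obtain D' where D': "G_metric (orbits {..Suc n}) D'" "moves_finite (orbits {..Suc n}) D' \<epsilon>"
    and D'D: "\<And>x y. \<lbrakk>x \<in> orbits {..n}; y \<in> orbits {..n}\<rbrakk> \<Longrightarrow> D' x y = D x y"
    and D'f: "\<And>a. a \<in> A \<Longrightarrow> D' (0, Suc n) a = f a"
    by (rule G_metric_add_orbit[OF D A K], rule that)
  have pm': "pseudometric_on (orbits {..Suc n}) D'" using D'(1) by (simp add: G_metric_def)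
  obtain e1 :: "nat \<Rightarrow> 'g" where e1: "\<forall>g. \<forall>r>0. \<exists>m. D' (e1 m, Suc n) (g, Suc n) < r"
    using countable_dense_in_orbit[OF G D'(1), of "Suc n"] by auto
  define p :: "'g \<times> nat" where "p = (0, Suc n)"
  have pA: "p \<notin> A" using A(3) by (auto simp: p_def)
  have A': "A \<subseteq> orbits {..Suc n}" using A(3) by fastforce
  have p_in: "insert p A \<subseteq> orbits {..Suc n}" using A' by (auto simp: p_def)
  have D'p: "D' p a = f a" "D' a p = f a" if "a \<in> A" for a
    using D'f[OF that] pseudometric_onD(2)[OF pm', of a p] p_in that by (auto simp: p_def)
  define j1 where "j1 = j(p := u n)"
  have j1: "j1 p = u n" "\<And>a. a \<in> A \<Longrightarrow> j1 a = j a" using pA by (auto simp: j1_def)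
  have iso1: "isometric_into (insert p A) D' W j1"
    unfolding isometric_into_def
  proof (intro conjI ballI subsetI)
    fix w assume "w \<in> j1 ` insert p A"
    then show "w \<in> W" using j j1 u by (auto simp: isometric_into_def)
  next
    fix a b assume "a \<in> insert p A" "b \<in> insert p A"
    then consider "a = p" "b = p" | "a = p" "b \<in> A" | "a \<in> A" "b = p" | "a \<in> A" "b \<in> A" by blast
    then show "dist (j1 a) (j1 b) = D' a b"
    proof cases
      case 1
      then show ?thesis using pseudometric_onD(1)[OF pm', of p p] by (simp add: p_def)
    next
      case 2
      then show ?thesis using D'p[of b] by (simp add: j1 f_def)
    next
      case 3
      then show ?thesis using D'p[of a] by (simp add: j1 f_def dist_commute)
    next
      case 4
      then show ?thesis
        using D'D[OF subsetD[OF A(3)] subsetD[OF A(3)], of a b] j by (simp add: j1 isometric_into_def)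
    qed
  qed
  define e' where "e' = e(Suc n := e1)"
  define B where "B = (\<lambda>(k, m). (e' k m, k)) ` ({..n} \<times> {..n})"
  have B: "finite B" "B \<subseteq> orbits {..Suc n}" by (auto simp: B_def)
  obtain j' where j': "\<And>a. a \<in> insert p A \<Longrightarrow> j' a = j1 a" "isometric_into (insert p A \<union> B) D' W j'"
    by (rule partial_isometry_extend[OF pm' W _ p_in iso1 B]) (use A(1) in simp, rule that)
  have "stage W \<epsilon> (Suc n) (D', insert p A \<union> B, j', e')"
    unfolding stage_def prod.case
  proof (intro conjI allI impI)
    fix k g and r :: real assume k: "k \<le> Suc n" and r: "r > 0"
    show "\<exists>m. D' (e' k m, k) (g, k) < r"
    proof (cases "k = Suc n")
      case True
      then show ?thesis using e1 r by (simp add: e'_def)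
    next
      case False
      then have "k \<le> n" using k by simp
      then show ?thesis using e[OF _ r, of k g] D'D by (auto simp: e'_def)
    qed
  qed (use D' A(1) B p_in j'(2) in auto)
  moreover have "stage_step u n (D, A, j, e) (D', insert p A \<union> B, j', e')"
    unfolding stage_step_def prod.case
  proof (intro conjI ballI allI impI)
    show "u n \<in> j' ` (insert p A \<union> B)" using j'(1)[of p] j1(1) by (intro image_eqI[of _ _ p]) auto
    show "j' a = j a" if "a \<in> A" for a using j'(1)[of a] j1(2)[OF that] that by simp
    show "(e' k m, k) \<in> insert p A \<union> B" if "k \<le> n" "m \<le> n" for k m
      unfolding B_def using that by (intro UnI2 image_eqI[of _ _ "(k, m)"]) auto
  qed (use D'D in \<open>auto simp: e'_def\<close>)
  ultimately show ?thesis by blast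
qed

lemma ex_dense_G_metric:
  fixes W :: "'w::metric_space set"
  assumes G: "omega_bounded_group TYPE('g::topological_group_add)" "\<not> precompact_group TYPE('g::topological_group_add)"
    and W: "one_point_extendable W" and u: "range (u :: nat \<Rightarrow> 'w) \<subseteq> W"
  obtains D :: "'g::topological_group_add \<times> nat \<Rightarrow> 'g \<times> nat \<Rightarrow> real" and \<epsilon> A j
  where "G_metric UNIV D" "\<epsilon> > 0" "moves_finite UNIV D \<epsilon>" "isometric_into A D W j"
    "range u \<subseteq> j ` A" "\<And>x r. r > 0 \<Longrightarrow> \<exists>a\<in>A. D a x < r"
proof -
  obtain D0 :: "'g \<times> nat \<Rightarrow> 'g \<times> nat \<Rightarrow> real" and \<epsilon>
    where D0: "G_metric (orbits {..0}) D0" "\<epsilon> > 0" "moves_finite (orbits {..0}) D0 \<epsilon>"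
    by (rule ex_initial_G_metric[OF G(2)], rule that)
  obtain e0 :: "nat \<Rightarrow> 'g" where e0: "\<forall>g. \<forall>r>0. \<exists>m. D0 (e0 m, 0) (g, 0) < r"
    using countable_dense_in_orbit[OF G(1) D0(1), of 0] by auto
  have pm0: "pseudometric_on (orbits {..0}) D0" using D0(1) by (simp add: G_metric_def)
  have "D0 (0, 0) (0, 0) = 0" using pseudometric_onD(1)[OF pm0, of "(0, 0)" "(0, 0)"] by simp
  \<comment> \<open>A single point may be sent anywhere in \<open>W\<close>. Only entry
    \<open>0\<close> of the constant family \<open>e0\<close> matters; the others are overwritten as
    their orbits appear.\<close>
  then have st0: "stage W \<epsilon> 0 (D0, {(0, 0)}, \<lambda>_. u 0, \<lambda>_. e0)"
    using D0 e0 u by (auto simp: stage_def isometric_into_def)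
  have "\<exists>s. \<forall>n. stage W \<epsilon> n (s n :: ('g \<times> nat \<Rightarrow> 'g \<times> nat \<Rightarrow> real) \<times> _ \<times> _ \<times> _) \<and> stage_step u n (s n) (s (Suc n))"
  proof (rule dependent_nat_choice)
    show "\<exists>s. stage W \<epsilon> 0 (s :: ('g \<times> nat \<Rightarrow> 'g \<times> nat \<Rightarrow> real) \<times> _ \<times> _ \<times> _)" using st0 by blast
    fix s :: "('g \<times> nat \<Rightarrow> 'g \<times> nat \<Rightarrow> real) \<times> _ \<times> _ \<times> _" and n
    assume "stage W \<epsilon> n s"
    moreover have "u n \<in> W" using u by blast
    ultimately show "\<exists>s'. stage W \<epsilon> (Suc n) s' \<and> stage_step u n s s'"
      by (cases s) (simp only: stage_extend[OF G(1) W])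
  qed
  then obtain s :: "nat \<Rightarrow> ('g \<times> nat \<Rightarrow> 'g \<times> nat \<Rightarrow> real) \<times> ('g \<times> nat) set \<times> ('g \<times> nat \<Rightarrow> 'w) \<times> (nat \<Rightarrow> nat \<Rightarrow> 'g)"
    where s: "\<And>n. stage W \<epsilon> n (s n)" "\<And>n. stage_step u n (s n) (s (Suc n))" by blast
  define D where "D n = fst (s n)" for n
  define A where "A n = fst (snd (s n))" for n
  define j where "j n = fst (snd (snd (s n)))" for n
  define e where "e n = snd (snd (snd (s n)))" for n
  have s_eq: "s n = (D n, A n, j n, e n)" for n by (simp add: D_def A_def j_def e_def)
  have Dn: "G_metric (orbits {..n}) (D n)" "moves_finite (orbits {..n}) (D n) \<epsilon>"
    and An: "A n \<subseteq> orbits {..n}" and iso: "isometric_into (A n) (D n) W (j n)"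
    and en: "\<And>k g r. \<lbrakk>k \<le> n; r > 0\<rbrakk> \<Longrightarrow> \<exists>m. D n (e n k m, k) (g, k) < r" for n
    using s(1)[of n] by (auto simp: s_eq stage_def)
  have D_Suc: "\<And>x y. \<lbrakk>snd x \<le> n; snd y \<le> n\<rbrakk> \<Longrightarrow> D (Suc n) x y = D n x y"
    and A_Suc: "A n \<subseteq> A (Suc n)" and j_Suc: "\<And>a. a \<in> A n \<Longrightarrow> j (Suc n) a = j n a"
    and e_Suc: "\<And>k. k \<le> n \<Longrightarrow> e (Suc n) k = e n k" and u_in: "u n \<in> j (Suc n) ` A (Suc n)"
    and e_in: "\<And>k m. \<lbrakk>k \<le> n; m \<le> n\<rbrakk> \<Longrightarrow> (e (Suc n) k m, k) \<in> A (Suc n)" for n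
    using s(2)[of n] unfolding s_eq stage_step_def by (auto simp: mem_Times_iff)
  have D_mono: "D m x y = D n x y" if "n \<le> m" "snd x \<le> n" "snd y \<le> n" for m n x y
    using that by (induction m rule: dec_induct) (simp_all add: D_Suc)
  have A_mono: "A n \<subseteq> A m" if "n \<le> m" for m n using lift_Suc_mono_le[of A] A_Suc that by blast
  have j_mono: "j m a = j n a" if "n \<le> m" "a \<in> A n" for m n a
    using that(1)
  proof (induction m rule: dec_induct)
    case (step m)
    then show ?case using j_Suc[of a m] A_mono[of n m] that(2) by auto
  qed simp
  have e_mono: "e m k = e n k" if "n \<le> m" "k \<le> n" for m n k
    using that by (induction m rule: dec_induct) (simp_all add: e_Suc)
  \<comment> \<open>The first stage containing both orbits settles the distance, as later stages
    extend it.\<close>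
  define Dl where "Dl x y = D (max (snd x) (snd y)) x y" for x y
  have D_inf: "Dl x y = D n x y" if "snd x \<le> n" "snd y \<le> n" for x y n
    unfolding Dl_def using that by (intro D_mono[symmetric]) auto
  define Al where "Al = (\<Union>n. A n)"
  define jl where "jl a = j (LEAST n. a \<in> A n) a" for a
  have j_inf: "jl a = j n a" if "a \<in> A n" for a n
    unfolding jl_def using that by (intro j_mono[symmetric]) (auto intro: Least_le LeastI)
  have A_snd: "snd a \<le> n" if "a \<in> A n" for a n using subsetD[OF An that] by (simp add: mem_Times_iff)
  show ?thesis
  proof (rule that[of Dl \<epsilon> Al jl])
    have pmn: "pseudometric_on (orbits {..n}) (D n)" for n using Dn(1) by (simp add: G_metric_def)
    show "G_metric UNIV Dl"
      unfolding G_metric_def pseudometric_on_def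
    proof (intro conjI ballI allI)
      fix x y z :: "'g \<times> nat" and g
      define n where "n = max (snd x) (max (snd y) (snd z))"
      have n: "snd x \<le> n" "snd y \<le> n" "snd z \<le> n" by (auto simp: n_def)
      then have xyz: "x \<in> orbits {..n}" "y \<in> orbits {..n}" "z \<in> orbits {..n}" by (auto simp: mem_Times_iff)
      show "Dl x x = 0" "Dl x y = Dl y x" "Dl x z \<le> Dl x y + Dl y z"
        using pseudometric_onD[OF pmn xyz(1,2)] xyz(3) n by (simp_all add: D_inf[of _ n])
      have "D n (shift g x) (shift g y) = D n x y" "((\<lambda>g. D n (shift g x) x) \<longlongrightarrow> 0) (nhds 0)"
        using Dn(1)[of n] xyz unfolding G_metric_def by blast+
      then show "Dl (shift g x) (shift g y) = Dl x y" "((\<lambda>g. Dl (shift g x) x) \<longlongrightarrow> 0) (nhds 0)"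
        using n by (simp_all add: D_inf[of _ n])
    qed
    show "moves_finite UNIV Dl \<epsilon>"
      unfolding moves_finite_def
    proof (intro allI impI)
      fix Y :: "('g \<times> nat) set" assume Y: "finite Y"
      define n where "n = Max (insert 0 (snd ` Y))"
      have n: "snd y \<le> n" if "y \<in> Y" for y using Y that by (simp add: n_def)
      then have "Y \<subseteq> orbits {..n}" by (auto simp: mem_Times_iff)
      then obtain g where "\<forall>y\<in>Y. \<forall>y'\<in>Y. \<epsilon> \<le> D n y (shift g y')"
        using Dn(2)[of n] Y unfolding moves_finite_def by blast
      then show "\<exists>g. \<forall>y\<in>Y. \<forall>y'\<in>Y. \<epsilon> \<le> Dl y (shift g y')"
        using n by (intro exI[of _ g]) (simp add: D_inf[of _ n])
    qed
    show "isometric_into Al Dl W jl"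
      unfolding isometric_into_def
    proof (intro conjI ballI subsetI)
      fix w assume "w \<in> jl ` Al"
      then obtain a n where "a \<in> A n" "w = jl a" by (auto simp: Al_def)
      then show "w \<in> W" using iso[of n] by (auto simp: j_inf[of _ n] isometric_into_def)
    next
      fix a b assume "a \<in> Al" "b \<in> Al"
      then obtain l m where "a \<in> A l" "b \<in> A m" by (auto simp: Al_def)
      then have ab: "a \<in> A (max l m)" "b \<in> A (max l m)"
        using A_mono[of l "max l m"] A_mono[of m "max l m"] by auto
      then show "dist (jl a) (jl b) = Dl a b"
        using iso[of "max l m"] by (simp add: j_inf[OF ab(1)] j_inf[OF ab(2)] D_inf[OF A_snd[OF ab(1)] A_snd[OF ab(2)]] isometric_into_def)
    qed
    show "range u \<subseteq> jl ` Al"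
    proof clarify
      fix n
      obtain a where a: "a \<in> A (Suc n)" "u n = j (Suc n) a" using u_in by blast
      then have "a \<in> Al" by (auto simp: Al_def)
      then show "u n \<in> jl ` Al" using j_inf[OF a(1)] a(2) by (metis imageI)
    qed
    fix x :: "'g \<times> nat" and r :: real assume r: "r > 0"
    obtain g k where x: "x = (g, k)" by (cases x)
    obtain m where m: "D k (e k k m, k) (g, k) < r" using en[of k k r g] r by auto
    \<comment> \<open>The sequence of orbit \<open>k\<close> is final from stage \<open>k\<close>
      on, and its entry \<open>m\<close> is matched at the latest at stage
      \<open>Suc (max k m)\<close>.\<close>
    define n where "n = max k m"
    have "(e (Suc n) k m, k) \<in> A (Suc n)" by (rule e_in) (auto simp: n_def)
    moreover have "e (Suc n) k = e k k" by (rule e_mono) (auto simp: n_def)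
    ultimately have "(e k k m, k) \<in> Al" by (auto simp: Al_def)
    then show "\<exists>a\<in>Al. Dl a x < r" using m x by (intro bexI[of _ "(e k k m, k)"]) (auto simp: D_inf[of _ k])
  qed (rule D0(2))
qed

text \<open>The matched set \<open>A\<close> need not be invariant under the group. As it is dense
  and \<open>W\<close> is complete, \<open>j\<close> extends by limits to all of
  \<open>G \<times> nat\<close>, where every \<open>shift g\<close> is available; the image is dense
  because it contains the sequence \<open>u\<close>.\<close>

lemma ex_G_metric_completing_to:
  fixes W :: "'w::metric_space set"
  assumes G: "omega_bounded_group TYPE('g::topological_group_add)" "\<not> precompact_group TYPE('g::topological_group_add)"
    and W: "one_point_extendable W" "complete W" and u: "range (u :: nat \<Rightarrow> 'w) \<subseteq> W" "W \<subseteq> closure (range u)"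
  obtains D :: "'g::topological_group_add \<times> nat \<Rightarrow> 'g \<times> nat \<Rightarrow> real" and \<epsilon> and \<kappa> :: "'g::topological_group_add \<times> nat \<Rightarrow> 'w"
  where "G_metric UNIV D" "\<epsilon> > 0" "moves_finite UNIV D \<epsilon>" "isometric_into UNIV D W \<kappa>"
    "W \<subseteq> closure (range \<kappa>)"
proof -
  obtain D :: "'g \<times> nat \<Rightarrow> 'g \<times> nat \<Rightarrow> real" and \<epsilon> A j
    where D: "G_metric UNIV D" "\<epsilon> > 0" "moves_finite UNIV D \<epsilon>" and j: "isometric_into A D W j"
      and uj: "range u \<subseteq> j ` A" and dense: "\<And>x r. r > 0 \<Longrightarrow> \<exists>a\<in>A. D a x < r"
    by (rule ex_dense_G_metric[OF G W(1) u(1)], rule that)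
  have pm: "pseudometric_on UNIV D" using D(1) by (simp add: G_metric_def)
  have sym: "D x y = D y x" and nonneg: "0 \<le> D x y" and tri: "D x z \<le> D x y + D y z" for x y z
    using pseudometric_onD[OF pm, of x y] by auto
  have "\<exists>c. (\<forall>n. c n \<in> A) \<and> (\<lambda>n. D (c n) x) \<longlonglongrightarrow> 0" for x
  proof -
    have "\<exists>c. \<forall>n. c n \<in> A \<and> D (c n) x < inverse (real (Suc n))"
      using dense by (intro choice) (metis inverse_positive_iff_positive of_nat_0_less_iff zero_less_Suc)
    then obtain c where c: "\<And>n. c n \<in> A" "\<And>n. D (c n) x < inverse (real (Suc n))" by blast
    have "(\<lambda>n. D (c n) x) \<longlonglongrightarrow> 0"
      using c(2) nonneg LIMSEQ_inverse_real_of_nat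
      by (intro tendsto_sandwich[OF _ _ tendsto_const LIMSEQ_inverse_real_of_nat]) (auto intro!: always_eventually less_imp_le)
    then show ?thesis using c(1) by blast
  qed
  then obtain c where c: "\<And>x n. c x n \<in> A" "\<And>x. (\<lambda>n. D (c x n) x) \<longlonglongrightarrow> 0" by metis
  have dist_j: "dist (j a) (j b) = D a b" and jW: "j a \<in> W" if "a \<in> A" "b \<in> A" for a b
    using j that by (auto simp: isometric_into_def)
  have "\<exists>w\<in>W. (\<lambda>n. j (c x n)) \<longlonglongrightarrow> w" for x
  proof -
    have "Cauchy (\<lambda>n. j (c x n))"
      unfolding Cauchy_def
    proof (intro allI impI)
      fix r :: real assume "r > 0"
      then have "\<forall>\<^sub>F n in sequentially. D (c x n) x < r/2" using c(2)[of x] by (intro order_tendstoD) auto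
      then obtain N where N: "\<And>n. n \<ge> N \<Longrightarrow> D (c x n) x < r/2" by (auto simp: eventually_sequentially)
      have "dist (j (c x m)) (j (c x n)) < r" if "m \<ge> N" "n \<ge> N" for m n
        using N[OF that(1)] N[OF that(2)] tri[of "c x m" "c x n" x] sym[of x] dist_j[OF c(1) c(1)] by simp
      then show "\<exists>N. \<forall>m\<ge>N. \<forall>n\<ge>N. dist (j (c x m)) (j (c x n)) < r" by blast
    qed
    then show ?thesis
      using W(2)[unfolded complete_def, rule_format, of "\<lambda>n. j (c x n)"] jW[OF c(1) c(1)] by simp
  qed
  then obtain \<kappa> where \<kappa>: "\<And>x. \<kappa> x \<in> W" "\<And>x. (\<lambda>n. j (c x n)) \<longlonglongrightarrow> \<kappa> x" by metis
  have dist_\<kappa>: "dist (\<kappa> x) (\<kappa> y) = D x y" for x y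
  proof (rule LIMSEQ_unique)
    show "(\<lambda>n. dist (j (c x n)) (j (c y n))) \<longlonglongrightarrow> dist (\<kappa> x) (\<kappa> y)"
      by (intro tendsto_dist \<kappa>)
    have "\<bar>D (c x n) (c y n) - D x y\<bar> \<le> D (c x n) x + D (c y n) y" for n
      using tri[of "c x n" "c y n" x] tri[of x "c y n" y] tri[of x y "c x n"] tri[of "c x n" y "c y n"]
        sym[of x "c x n"] sym[of y "c y n"] by linarith
    then have "\<forall>\<^sub>F n in sequentially. norm (D (c x n) (c y n) - D x y) \<le> D (c x n) x + D (c y n) y"
      by simp
    moreover have "(\<lambda>n. D (c x n) x + D (c y n) y) \<longlonglongrightarrow> 0"
      using tendsto_add[OF c(2)[of x] c(2)[of y]] by simp
    ultimately have "(\<lambda>n. D (c x n) (c y n) - D x y) \<longlonglongrightarrow> 0" by (rule Lim_null_comparison)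
    then show "(\<lambda>n. dist (j (c x n)) (j (c y n))) \<longlonglongrightarrow> D x y"
      using dist_j[OF c(1) c(1)] by (simp add: LIM_zero_iff)
  qed
  have "\<kappa> a = j a" if "a \<in> A" for a
  proof (rule LIMSEQ_unique[OF \<kappa>(2)])
    have "(\<lambda>n. dist (j (c a n)) (j a)) \<longlonglongrightarrow> 0" using c(2)[of a] dist_j[OF c(1) that] by simp
    then show "(\<lambda>n. j (c a n)) \<longlonglongrightarrow> j a" by (rule tendsto_dist_iff[THEN iffD2])
  qed
  then have "\<kappa> ` A = j ` A" by (rule image_cong[OF refl])
  then have "range u \<subseteq> range \<kappa>" using uj image_mono[OF subset_UNIV, of \<kappa> A] by simp
  then have "closure (range u) \<subseteq> closure (range \<kappa>)" by (rule closure_mono)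
  with u(2) have "W \<subseteq> closure (range \<kappa>)" by (rule order_trans)
  moreover have "isometric_into UNIV D W \<kappa>"
    using dist_\<kappa> \<kappa>(1) by (simp add: isometric_into_def image_subset_iff)
  ultimately show ?thesis by (rule that[OF D, rotated])
qed

section \<open>The norm of the Holmes space\<close>

text \<open>Points \<open>z\<close> and \<open>w\<close> are chosen so far away that every \<open>y i\<close> lies metrically between them, at the
  position prescribed by \<open>f\<close>. Splitting a multiple of \<open>w - z\<close> through the \<open>y i\<close> then leaves no room
  for the combination of the \<open>y i\<close> to be short.\<close>

lemma norm_sum_ge_Lipschitz_sum:
  fixes y :: "'i \<Rightarrow> 'b::real_normed_vector"
  assumes W: "one_point_extendable W" and I: "finite I" and y: "\<And>i. i \<in> I \<Longrightarrow> y i \<in> W"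
    and c: "(\<Sum>i\<in>I. c i) = 0"
    and f: "\<And>i k. \<lbrakk>i \<in> I; k \<in> I\<rbrakk> \<Longrightarrow> f i - f k \<le> dist (y i) (y k)"
  shows "(\<Sum>i\<in>I. c i * f i) \<le> norm (\<Sum>i\<in>I. c i *\<^sub>R y i)"
proof -
  \<comment> \<open>\<open>C\<close> is large enough for the prescribed distances
    \<open>C + f i\<close> to \<open>z\<close> and \<open>C - f i\<close> to \<open>w\<close> to
    satisfy the Katetov inequalities; the summand \<open>1\<close> keeps \<open>z\<close> apart from
    all \<open>y i\<close>.\<close>
  define C where "C = 1 + (\<Sum>i\<in>I. \<bar>f i\<bar>) + (\<Sum>i\<in>I. \<Sum>k\<in>I. dist (y i) (y k))"
  have f_le: "\<bar>f i\<bar> \<le> (\<Sum>i\<in>I. \<bar>f i\<bar>)" if "i \<in> I" for i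
    using that I by (intro member_le_sum) auto
  have d_le: "dist (y i) (y k) \<le> (\<Sum>i\<in>I. \<Sum>k\<in>I. dist (y i) (y k))" if "i \<in> I" "k \<in> I" for i k
  proof -
    have "dist (y i) (y k) \<le> (\<Sum>k\<in>I. dist (y i) (y k))"
      using that I by (intro member_le_sum) auto
    also have "\<dots> \<le> (\<Sum>i\<in>I. \<Sum>k\<in>I. dist (y i) (y k))"
      using that I by (intro member_le_sum[of i I "\<lambda>i. \<Sum>k\<in>I. dist (y i) (y k)"]) (auto intro: sum_nonneg)
    finally show ?thesis .
  qed
  have C: "\<bar>f i\<bar> + 1 \<le> C" "dist (y i) (y k) \<le> 2 * C - \<bar>f i\<bar> - \<bar>f k\<bar>" if "i \<in> I" "k \<in> I" for i k
    using f_le[OF that(1)] f_le[OF that(2)] d_le[OF that] d_le[OF that(1,1)] unfolding C_def by simp_all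
  have f_C: "f i \<le> C" "- f i \<le> C" if "i \<in> I" for i using C(1)[OF that that] by auto
  have C_pos: "1 \<le> C" unfolding C_def by (simp add: sum_nonneg)
  \<comment> \<open>\<open>y\<close> may repeat points, so prescribed distances need an index for
    each point; the Lipschitz condition makes \<open>f\<close> independent of the index
    chosen.\<close>
  define v where "v = inv_into I y"
  have v: "v (y i) \<in> I" "y (v (y i)) = y i" "f (v (y i)) = f i" if i: "i \<in> I" for i
  proof -
    show 1: "v (y i) \<in> I" "y (v (y i)) = y i"
      using i by (auto simp: v_def intro: inv_into_into f_inv_into_f)
    show "f (v (y i)) = f i" using f[OF 1(1) i] f[OF i 1(1)] 1(2) by simp
  qed
  have "Katetov_on (y ` I) dist (\<lambda>p. C + f (v p))"
    unfolding Katetov_on_def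
  proof clarify
    fix i k assume "i \<in> I" "k \<in> I"
    then show "C + f (v (y i)) \<le> dist (y i) (y k) + (C + f (v (y k))) \<and>
        dist (y i) (y k) \<le> C + f (v (y i)) + (C + f (v (y k)))"
      using C(2)[of i k] f[of i k] by (simp add: v)
  qed
  moreover have "finite (y ` I)" "y ` I \<subseteq> W" using I y by auto
  ultimately have "\<exists>z\<in>W. \<forall>p\<in>y ` I. dist z p = C + f (v p)"
    by (intro one_point_extendableD[OF W])
  then obtain z where z: "z \<in> W" "\<And>i. i \<in> I \<Longrightarrow> dist z (y i) = C + f i"
    by (auto simp: v(3))
  have zy: "z \<noteq> y i" if "i \<in> I" for i using z(2)[OF that] C(1)[OF that that] by auto
  define h where "h p = (if p = z then 2 * C else C - f (v p))" for p
  have h: "h z = 2 * C" "\<And>i. i \<in> I \<Longrightarrow> h (y i) = C - f i" using zy v(3) by (auto simp: h_def)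
  have "Katetov_on (insert z (y ` I)) dist h"
    unfolding Katetov_on_def
  proof (intro ballI)
    fix p q assume "p \<in> insert z (y ` I)" "q \<in> insert z (y ` I)"
    then consider "p = z" "q = z" | i where "p = z" "i \<in> I" "q = y i" | i where "i \<in> I" "p = y i" "q = z"
      | i k where "i \<in> I" "k \<in> I" "p = y i" "q = y k" by auto
    then show "h p \<le> dist p q + h q \<and> dist p q \<le> h p + h q"
    proof cases
      case 1
      then show ?thesis using C_pos by (simp add: h)
    next
      case (2 i)
      then show ?thesis using z(2)[of i] f_C[of i] by (auto simp: h)
    next
      case (3 i)
      then show ?thesis using z(2)[of i] f_C[of i] by (auto simp: h dist_commute)
    next
      case (4 i k)
      then show ?thesis using C(2)[of i k] f[of k i] by (simp add: h dist_commute)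
    qed
  qed
  moreover have "finite (insert z (y ` I))" "insert z (y ` I) \<subseteq> W" using I y z(1) by auto
  ultimately have "\<exists>w\<in>W. \<forall>p\<in>insert z (y ` I). dist w p = h p"
    by (intro one_point_extendableD[OF W])
  then obtain w where w: "\<And>p. p \<in> insert z (y ` I) \<Longrightarrow> dist w p = h p" by blast
  have wz: "norm (w - z) = 2 * C" using w[of z] h(1) by (simp add: dist_norm)
  have wy: "norm (w - y i) = C - f i" if "i \<in> I" for i
    using w[of "y i"] h(2)[OF that] that by (simp add: dist_norm)
  have yz: "norm (y i - z) = C + f i" if "i \<in> I" for i
    using z(2)[OF that] by (simp add: dist_norm norm_minus_commute)
  define a b where "a i = max (c i) 0" and "b i = max (- c i) 0" for i
  have ab: "0 \<le> a i" "0 \<le> b i" "c i = a i - b i" for i by (auto simp: a_def b_def)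
  define S where "S = (\<Sum>i\<in>I. a i)"
  have S: "S = (\<Sum>i\<in>I. b i)" using c by (simp add: S_def ab(3) sum_subtractf)
  \<comment> \<open>Positive and negative parts of \<open>c\<close> have the same total mass
    \<open>S\<close>. The left side has norm \<open>2 * C * S\<close>; the last two sums have norms
    adding up to at most \<open>2 * C * S\<close> minus the sum of the \<open>c i * f i\<close>,
    which leaves the claimed lower bound for the first sum.\<close>
  have "S *\<^sub>R (w - z) = (\<Sum>i\<in>I. c i *\<^sub>R y i) + (\<Sum>i\<in>I. a i *\<^sub>R (w - y i)) + (\<Sum>i\<in>I. b i *\<^sub>R (y i - z))"
  proof -
    have "(\<Sum>i\<in>I. c i *\<^sub>R y i) + (\<Sum>i\<in>I. a i *\<^sub>R (w - y i)) + (\<Sum>i\<in>I. b i *\<^sub>R (y i - z))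
      = (\<Sum>i\<in>I. a i *\<^sub>R w - b i *\<^sub>R z)"
      unfolding sum.distrib[symmetric] by (rule sum.cong) (auto simp: ab(3) algebra_simps)
    also have "\<dots> = (\<Sum>i\<in>I. a i) *\<^sub>R w - (\<Sum>i\<in>I. b i) *\<^sub>R z"
      by (simp add: sum_subtractf scaleR_sum_left)
    also have "\<dots> = S *\<^sub>R (w - z)" by (simp add: S_def[symmetric] S[symmetric] algebra_simps)
    finally show ?thesis by simp
  qed
  then have "norm (S *\<^sub>R (w - z)) \<le> norm (\<Sum>i\<in>I. c i *\<^sub>R y i)
      + norm (\<Sum>i\<in>I. a i *\<^sub>R (w - y i)) + norm (\<Sum>i\<in>I. b i *\<^sub>R (y i - z))"
    by (simp only:) (intro order_trans[OF norm_triangle_ineq add_right_mono] norm_triangle_ineq)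
  also have "norm (\<Sum>i\<in>I. a i *\<^sub>R (w - y i)) \<le> (\<Sum>i\<in>I. a i * (C - f i))"
    using ab(1) wy by (intro sum_norm_le) simp
  also have "norm (\<Sum>i\<in>I. b i *\<^sub>R (y i - z)) \<le> (\<Sum>i\<in>I. b i * (C + f i))"
    using ab(2) yz by (intro sum_norm_le) simp
  also have "norm (S *\<^sub>R (w - z)) = 2 * C * S"
  proof -
    have "0 \<le> S" unfolding S_def by (intro sum_nonneg ab)
    then show ?thesis using wz by simp
  qed
  finally have "2 * C * S \<le> norm (\<Sum>i\<in>I. c i *\<^sub>R y i) + (\<Sum>i\<in>I. a i * (C - f i)) + (\<Sum>i\<in>I. b i * (C + f i))"
    by simp
  moreover have "(\<Sum>i\<in>I. a i * (C - f i)) + (\<Sum>i\<in>I. b i * (C + f i)) = 2 * C * S - (\<Sum>i\<in>I. c i * f i)"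
  proof -
    have "(\<Sum>i\<in>I. a i * (C - f i)) + (\<Sum>i\<in>I. b i * (C + f i)) = (\<Sum>i\<in>I. C * a i + C * b i - c i * f i)"
      unfolding sum.distrib[symmetric] by (rule sum.cong) (auto simp: ab(3) algebra_simps)
    also have "\<dots> = C * (\<Sum>i\<in>I. a i) + C * (\<Sum>i\<in>I. b i) - (\<Sum>i\<in>I. c i * f i)"
      by (simp add: sum_subtractf sum.distrib sum_distrib_left)
    finally show ?thesis by (simp add: S_def[symmetric] S[symmetric])
  qed
  ultimately show ?thesis by linarith
qed

section \<open>Norming functionals on finitely many vectors, and Holmes' theorem\<close>

definition sublinear :: "('a::real_vector \<Rightarrow> real) \<Rightarrow> bool" where
  "sublinear q \<longleftrightarrow> (\<forall>x y. q (x + y) \<le> q x + q y) \<and> (\<forall>t x. 0 \<le> t \<longrightarrow> q (t *\<^sub>R x) = t * q x)"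

lemma sublinearD:
  assumes "sublinear q"
  shows "q (x + y) \<le> q x + q y" "0 \<le> t \<Longrightarrow> q (t *\<^sub>R x) = t * q x" "q 0 = 0" "0 \<le> q x + q (- x)"
proof -
  show 1: "q (x + y) \<le> q x + q y" and 2: "0 \<le> t \<Longrightarrow> q (t *\<^sub>R x) = t * q x" for x y t
    using assms by (simp_all add: sublinear_def)
  show 3: "q 0 = 0" using 2[of 0 0] by simp
  show "0 \<le> q x + q (- x)" using 1[of x "- x"] 3 by simp
qed

text \<open>The Hahn--Banach step. Linearity is needed on finitely many vectors only, so that finitely many
  steps do and Zorn's lemma is not needed.\<close>

lemma sublinear_linearize:
  assumes q: "sublinear q"
  obtains q' where "sublinear q'" "\<And>y. q' y \<le> q y" "q' (- x) = - q' x" "q' x = q x"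
    "\<And>z. q (- z) = - q z \<Longrightarrow> q' (- z) = - q' z \<and> q' z = q z"
proof -
  note qD = sublinearD[OF q]
  \<comment> \<open>The term \<open>t = 0\<close> gives \<open>q' \<le> q\<close>, and
    \<open>t = 1\<close> at \<open>- x\<close> gives \<open>q' (- x) \<le> - q x\<close>, which
    makes \<open>q'\<close> odd at \<open>x\<close>. Subadditivity bounds the infimum from
    below.\<close>
  define q' where "q' y = (INF t\<in>{0..}. q (y + t *\<^sub>R x) - t * q x)" for y
  have bdd: "bdd_below ((\<lambda>t. q (y + t *\<^sub>R x) - t * q x) ` {0..})" for y
  proof (rule bdd_belowI2)
    fix t :: real assume "t \<in> {0..}"
    then show "- q (- y) \<le> q (y + t *\<^sub>R x) - t * q x"
      using qD(1)[of "y + t *\<^sub>R x" "- y"] qD(2)[of t x] by simp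
  qed
  have le: "q' y \<le> q (y + t *\<^sub>R x) - t * q x" if "0 \<le> t" for y t
    unfolding q'_def using bdd that by (intro cINF_lower) auto
  have ge: "r \<le> q' y" if "\<And>t. 0 \<le> t \<Longrightarrow> r \<le> q (y + t *\<^sub>R x) - t * q x" for y r
    unfolding q'_def using that by (intro cINF_greatest) auto
  have less: "\<exists>t\<ge>0. q (y + t *\<^sub>R x) - t * q x < q' y + r" if "r > 0" for y r
  proof (rule ccontr)
    assume "\<not> ?thesis"
    then have "q' y + r \<le> q' y" by (intro ge) (auto simp: not_less)
    then show False using that by simp
  qed
  have le_q: "q' y \<le> q y" for y using le[of 0 y] by simp
  have add: "q' (y + z) \<le> q' y + q' z" for y z
  proof (rule field_le_epsilon)
    fix r :: real assume "r > 0"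
    then obtain s t where st: "0 \<le> s" "q (y + s *\<^sub>R x) - s * q x < q' y + r/2"
      "0 \<le> t" "q (z + t *\<^sub>R x) - t * q x < q' z + r/2"
      using less[of "r/2" y] less[of "r/2" z] by auto
    have "q' (y + z) \<le> q ((y + z) + (s + t) *\<^sub>R x) - (s + t) * q x" using st by (intro le) simp
    also have "(y + z) + (s + t) *\<^sub>R x = (y + s *\<^sub>R x) + (z + t *\<^sub>R x)" by (simp add: algebra_simps)
    also have "q \<dots> \<le> q (y + s *\<^sub>R x) + q (z + t *\<^sub>R x)" by (rule qD(1))
    finally show "q' (y + z) \<le> q' y + q' z + r" using st by (simp add: algebra_simps)
  qed
  have scale_le: "q' (s *\<^sub>R y) \<le> s * q' y" if s: "0 < s" for s y
  proof -
    have "q' (s *\<^sub>R y) / s \<le> q' y"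
    proof (rule ge)
      fix t :: real assume t: "0 \<le> t"
      have "q' (s *\<^sub>R y) \<le> q (s *\<^sub>R y + (s * t) *\<^sub>R x) - (s * t) * q x" using s t by (intro le) simp
      also have "s *\<^sub>R y + (s * t) *\<^sub>R x = s *\<^sub>R (y + t *\<^sub>R x)" by (simp add: algebra_simps)
      also have "q \<dots> = s * q (y + t *\<^sub>R x)" using s by (simp add: qD(2))
      finally show "q' (s *\<^sub>R y) / s \<le> q (y + t *\<^sub>R x) - t * q x" using s by (simp add: field_simps)
    qed
    then show ?thesis using s by (simp add: field_simps)
  qed
  have zero: "q' 0 = 0"
  proof (rule antisym)
    show "q' 0 \<le> 0" using le_q[of 0] qD(3) by simp
    show "0 \<le> q' 0" by (rule ge) (simp add: qD(2))
  qed
  have scale: "q' (s *\<^sub>R y) = s * q' y" if s: "0 \<le> s" for s y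
  proof (cases "s = 0")
    case False
    then have "0 < s" using s by simp
    have "q' ((1/s) *\<^sub>R (s *\<^sub>R y)) \<le> (1/s) * q' (s *\<^sub>R y)" using \<open>0 < s\<close> by (intro scale_le) simp
    then have "s * q' y \<le> q' (s *\<^sub>R y)" using \<open>0 < s\<close> by (simp add: field_simps)
    then show ?thesis using scale_le[OF \<open>0 < s\<close>, of y] by simp
  qed (simp add: zero)
  have sub: "sublinear q'" unfolding sublinear_def using add scale by blast
  have keep: "q' (- z) = - q' z \<and> q' z = q z" if "q (- z) = - q z" for z
    using le_q[of z] le_q[of "- z"] sublinearD(4)[OF sub, of z] that by linarith
  have "q' (- x) \<le> - q x" using le[of 1 "- x"] qD(3) by simp
  then have "q' (- x) = - q' x" "q' x = q x"
    using le_q[of x] sublinearD(4)[OF sub, of x] by linarith+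
  then show ?thesis using that[OF sub le_q] keep by blast
qed

text \<open>Starting from the norm, \<open>v\<close> is treated first and then each vector of
  \<open>X\<close>. Each step keeps the values at vectors where the function is already odd, in
  particular \<open>q v = norm v\<close>.\<close>

lemma ex_norming_sublinear:
  fixes v :: "'b::real_normed_vector"
  assumes "finite X"
  shows "\<exists>q. sublinear q \<and> (\<forall>y. q y \<le> norm y) \<and> q v = norm v \<and> q (- v) = - q v \<and> (\<forall>x\<in>X. q (- x) = - q x)"
  using assms
proof (induction X rule: finite_induct)
  case empty
  have n: "sublinear (norm :: 'b \<Rightarrow> real)" by (simp add: sublinear_def norm_triangle_ineq)
  show ?case by (rule sublinear_linearize[OF n, of v]) auto
next
  case (insert x X)
  then obtain q where q: "sublinear q" "\<forall>y. q y \<le> norm y" "q v = norm v" "q (- v) = - q v" "\<forall>x\<in>X. q (- x) = - q x"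
    by blast
  obtain q' where q': "sublinear q'" "\<And>y. q' y \<le> q y" "q' (- x) = - q' x" "q' x = q x"
    "\<And>z. q (- z) = - q z \<Longrightarrow> q' (- z) = - q' z \<and> q' z = q z"
    by (rule sublinear_linearize[OF q(1), of x], rule that)
  have "q' y \<le> norm y" for y using q(2) q'(2)[of y] by (meson order_trans)
  then show ?case using q q' by (intro exI[of _ q']) auto
qed

text \<open>Adding a vector at which \<open>q\<close> is odd is additive for \<open>q\<close>:
  subadditivity bounds the sum from one side, and applied to subtracting that vector again from the
  other.\<close>

lemma sublinear_sum:
  assumes q: "sublinear q" and x: "\<And>i. i \<in> I \<Longrightarrow> q (- x i) = - q (x i)" and I: "finite I"
  shows "q (\<Sum>i\<in>I. c i *\<^sub>R x i) = (\<Sum>i\<in>I. c i * q (x i))"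
  using I x
proof (induction I rule: finite_induct)
  case empty
  then show ?case by (simp add: sublinearD(3)[OF q])
next
  case (insert i I)
  have qi: "q (- x i) = - q (x i)" using insert.prems by simp
  have lin: "q (r *\<^sub>R x i) = r * q (x i)" for r
  proof (cases "0 \<le> r")
    case False
    then have "q ((- r) *\<^sub>R (- x i)) = (- r) * q (- x i)" by (intro sublinearD(2)[OF q]) simp
    then show ?thesis using qi by simp
  qed (rule sublinearD(2)[OF q])
  let ?y = "\<Sum>i\<in>I. c i *\<^sub>R x i" and ?z = "c i *\<^sub>R x i"
  have "q (?z + ?y) \<le> q ?z + q ?y" by (rule sublinearD(1)[OF q])
  moreover have "q ((?z + ?y) + (- c i) *\<^sub>R x i) \<le> q (?z + ?y) + q ((- c i) *\<^sub>R x i)" by (rule sublinearD(1)[OF q])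
  then have "q ?y \<le> q (?z + ?y) - q ?z" unfolding lin by simp
  ultimately have "q (?z + ?y) = q ?z + q ?y" by simp
  then show ?case using insert lin by simp
qed

text \<open>Holmes' theorem: a norming functional restricts to a \<open>1\<close>-Lipschitz function on the points.\<close>

lemma norm_sum_determined_by_dist:
  fixes x y :: "'i \<Rightarrow> 'b::real_normed_vector"
  assumes W: "one_point_extendable W" and I: "finite I"
    and x: "\<And>i. i \<in> I \<Longrightarrow> x i \<in> W" and y: "\<And>i. i \<in> I \<Longrightarrow> y i \<in> W"
    and xy: "\<And>i k. \<lbrakk>i \<in> I; k \<in> I\<rbrakk> \<Longrightarrow> dist (x i) (x k) = dist (y i) (y k)"
    and c: "(\<Sum>i\<in>I. c i) = 0"
  shows "norm (\<Sum>i\<in>I. c i *\<^sub>R x i) = norm (\<Sum>i\<in>I. c i *\<^sub>R y i)"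
proof -
  have le: "norm (\<Sum>i\<in>I. c i *\<^sub>R x i) \<le> norm (\<Sum>i\<in>I. c i *\<^sub>R y i)"
    if y: "\<And>i. i \<in> I \<Longrightarrow> y i \<in> W" and xy: "\<And>i k. \<lbrakk>i \<in> I; k \<in> I\<rbrakk> \<Longrightarrow> dist (x i) (x k) = dist (y i) (y k)"
    for x y :: "'i \<Rightarrow> 'b"
  proof -
    define v where "v = (\<Sum>i\<in>I. c i *\<^sub>R x i)"
    obtain q where q: "sublinear q" "\<And>z. q z \<le> norm z" "q v = norm v" "\<forall>z\<in>x ` I. q (- z) = - q z"
      using ex_norming_sublinear[OF finite_imageI[OF I], of v x] by blast
    have "q (x i) - q (x k) \<le> dist (y i) (y k)" if "i \<in> I" "k \<in> I" for i k
      using sublinearD(1)[OF q(1), of "x i - x k" "x k"] q(2)[of "x i - x k"] xy[OF that]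
      by (simp add: dist_norm)
    then have "(\<Sum>i\<in>I. c i * q (x i)) \<le> norm (\<Sum>i\<in>I. c i *\<^sub>R y i)"
      by (intro norm_sum_ge_Lipschitz_sum[OF W I y c]) auto
    moreover have "q v = (\<Sum>i\<in>I. c i * q (x i))"
      unfolding v_def using q(4) by (intro sublinear_sum[OF q(1) _ I]) auto
    ultimately show ?thesis using q(3) by (simp add: v_def)
  qed
  show ?thesis using le[OF y xy] le[OF x xy[symmetric]] by (rule antisym)
qed

section \<open>Linear isometries prescribed on a total family\<close>

lemma subspace_closure:
  fixes S :: "'a::real_normed_vector set"
  assumes "subspace S"
  shows "subspace (closure S)"
proof (rule subspaceI)
  show "0 \<in> closure S" using assms closure_subset subspace_0 by blast
  fix x y assume "x \<in> closure S" "y \<in> closure S"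
  then obtain f g where "\<forall>n. f n \<in> S" "f \<longlonglongrightarrow> x" "\<forall>n. g n \<in> S" "g \<longlonglongrightarrow> y"
    unfolding closure_sequential by blast
  then show "x + y \<in> closure S"
    unfolding closure_sequential using assms
    by (intro exI[of _ "\<lambda>n. f n + g n"]) (auto intro: tendsto_add subspace_add)
next
  fix x c assume "x \<in> closure S"
  then obtain f where "\<forall>n. f n \<in> S" "f \<longlonglongrightarrow> x" unfolding closure_sequential by blast
  then show "c *\<^sub>R x \<in> closure S"
    unfolding closure_sequential using assms
    by (intro exI[of _ "\<lambda>n. c *\<^sub>R f n"]) (auto intro!: tendsto_intros subspace_scale)
qed

text \<open>The graph of the isometry is the closed span of the pairs \<open>(t i, t' i)\<close>.\<close>

lemma ex_linear_isometry:
  fixes t t' :: "'i \<Rightarrow> 'b::banach"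
  assumes n: "\<And>I c. finite I \<Longrightarrow> norm (\<Sum>i\<in>I. c i *\<^sub>R t i) = norm (\<Sum>i\<in>I. c i *\<^sub>R t' i)"
    and dense: "closure (span (range t)) = UNIV"
  shows "\<exists>L. linear L \<and> (\<forall>v. norm (L v) = norm v) \<and> (\<forall>i. L (t i) = t' i)"
proof -
  define R where "R = span (range (\<lambda>i. (t i, t' i)))"
  have sub: "subspace R" by (simp add: R_def subspace_span)
  have norm_R: "norm (fst p) = norm (snd p)" if p: "p \<in> R" for p
  proof -
    obtain S u where S: "finite S" "S \<subseteq> range (\<lambda>i. (t i, t' i))" "p = (\<Sum>a\<in>S. u a *\<^sub>R a)"
      using p unfolding R_def span_explicit by blast
    \<comment> \<open>Choosing one index for each pair turns the combination of pairs into one over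
      indices, the form in which \<open>n\<close> applies.\<close>
    from S(2) obtain I where I: "inj_on (\<lambda>i. (t i, t' i)) I" "S = (\<lambda>i. (t i, t' i)) ` I"
      unfolding subset_image_inj by blast
    have "finite I" using S(1) finite_image_iff[OF I(1)] I(2) by simp
    have "p = (\<Sum>i\<in>I. u (t i, t' i) *\<^sub>R (t i, t' i))"
      unfolding S(3) I(2) sum.reindex[OF I(1)] comp_def ..
    then have "fst p = (\<Sum>i\<in>I. u (t i, t' i) *\<^sub>R t i)" "snd p = (\<Sum>i\<in>I. u (t i, t' i) *\<^sub>R t' i)"
      by (simp_all only: fst_sum snd_sum fst_scaleR snd_scaleR fst_conv snd_conv)
    then show ?thesis using n[OF \<open>finite I\<close>] by simp
  qed
  have norm_cR: "norm (fst p) = norm (snd p)" if "p \<in> closure R" for p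
  proof -
    have "closed {p :: 'b \<times> 'b. norm (fst p) = norm (snd p)}"
      by (intro closed_Collect_eq continuous_intros)
    then have "closure R \<subseteq> {p. norm (fst p) = norm (snd p)}"
      using norm_R by (intro closure_minimal) auto
    then show ?thesis using that by blast
  qed
  have fst_R: "fst ` R = span (range t)"
    unfolding R_def linear_span_image[OF linear_fst, symmetric] by (simp add: image_image)
  have ex: "\<exists>v'. (v, v') \<in> closure R" for v
  proof -
    have "v \<in> closure (fst ` R)" using dense by (simp add: fst_R)
    then obtain w where w: "\<And>n. w n \<in> fst ` R" "w \<longlonglongrightarrow> v" unfolding closure_sequential by blast
    have "\<exists>w'. (w n, w') \<in> R" for n using w(1)[of n] by auto
    then obtain w' where w': "\<And>n. (w n, w' n) \<in> R" by metis
    have dist_eq: "dist (w' m) (w' n) = dist (w m) (w n)" for m n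
      using norm_R[OF subspace_diff[OF sub w'[of m] w'[of n]]] by (simp add: dist_norm)
    have "Cauchy w" using w(2) by (rule LIMSEQ_imp_Cauchy)
    then have "Cauchy w'" by (simp add: Cauchy_def dist_eq)
    then have "\<exists>v'. w' \<longlonglongrightarrow> v'" by (simp add: Cauchy_convergent convergent_def[symmetric])
    then obtain v' where "w' \<longlonglongrightarrow> v'" by blast
    then have "(\<lambda>n. (w n, w' n)) \<longlonglongrightarrow> (v, v')" by (intro tendsto_Pair w)
    then have "(v, v') \<in> closure R" 
      unfolding closure_sequential using w' by (intro exI[of _ "\<lambda>n. (w n, w' n)"]) simp
    then show ?thesis by blast
  qed
  have subc: "subspace (closure R)" using sub by (rule subspace_closure)
  have unique: "a = b" if "(v, a) \<in> closure R" "(v, b) \<in> closure R" for v a b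
    using norm_cR[OF subspace_diff[OF subc that]] by simp
  obtain L where L: "\<And>v. (v, L v) \<in> closure R" using ex by metis
  have "linear L"
  proof (rule linearI)
    show "L (x + y) = L x + L y" for x y
      using subspace_add[OF subc L[of x] L[of y]] by (intro unique[OF L]) simp
    show "L (c *\<^sub>R x) = c *\<^sub>R L x" for c x
      using subspace_scale[OF subc L[of x], of c] by (intro unique[OF L]) simp
  qed
  moreover have "norm (L v) = norm v" for v using norm_cR[OF L[of v]] by simp
  moreover have "L (t i) = t' i" for i
  proof (rule unique[OF L])
    have "(t i, t' i) \<in> R" unfolding R_def by (rule span_base) simp
    then show "(t i, t' i) \<in> closure R" using closure_subset by blast
  qed
  ultimately show ?thesis by blast
qed

section \<open>The affine action on the Holmes space\<close>

text \<open>The base point joins the family under the index \<open>None\<close>, with the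
  coefficient that makes the total mass zero.\<close>

lemma norm_sum_diff_determined_by_dist:
  fixes x y :: "'i \<Rightarrow> 'b::real_normed_vector"
  assumes W: "one_point_extendable W" and I: "finite I"
    and x: "\<And>i. x i \<in> W" "p \<in> W" and y: "\<And>i. y i \<in> W" "q \<in> W"
    and xy: "\<And>i k. dist (x i) (x k) = dist (y i) (y k)" "\<And>i. dist (x i) p = dist (y i) q"
  shows "norm (\<Sum>i\<in>I. c i *\<^sub>R (x i - p)) = norm (\<Sum>i\<in>I. c i *\<^sub>R (y i - q))"
proof -
  define c' where "c' = case_option (- (\<Sum>i\<in>I. c i)) c"
  let ?J = "insert None (Some ` I)"
  have sum_J: "(\<Sum>i\<in>?J. c' i *\<^sub>R case_option r z i) = (\<Sum>i\<in>I. c i *\<^sub>R (z i - r))"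
    for z :: "'i \<Rightarrow> 'b" and r
    using I by (simp add: c'_def sum.reindex algebra_simps sum_subtractf scaleR_sum_left)
  have "(\<Sum>i\<in>?J. c' i) = 0" using I by (simp add: c'_def sum.reindex)
  moreover have "dist (case_option p x i) (case_option p x k) = dist (case_option q y i) (case_option q y k)" for i k
    using xy by (cases i; cases k) (simp_all add: dist_commute)
  moreover have "case_option p x i \<in> W" "case_option q y i \<in> W" for i
    using x y by (cases i; simp)+
  ultimately have "norm (\<Sum>i\<in>?J. c' i *\<^sub>R case_option p x i) = norm (\<Sum>i\<in>?J. c' i *\<^sub>R case_option q y i)"
    using I by (intro norm_sum_determined_by_dist[OF W]) auto
  then show ?thesis by (simp only: sum_J)
qed

lemma closed_subspace_eq_UNIV:
  fixes S :: "'b::real_normed_vector set"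
  assumes "closure (span T) = UNIV" "subspace S" "closed S" "T \<subseteq> S"
  shows "v \<in> S"
  using assms closure_minimal[OF span_minimal[OF assms(4,2)] assms(3)] by auto

text \<open>An \<open>e/3\<close> argument, possible because all \<open>L g\<close> are isometries.
  It reduces strong continuity to the vectors \<open>\<tau> x\<close>.\<close>

lemma closed_convergence_set:
  fixes L :: "'g::topological_space \<Rightarrow> 'b::metric_space \<Rightarrow> 'b"
  assumes L: "\<And>g u v. dist (L g u) (L g v) = dist u v"
  shows "closed {v. ((\<lambda>g. L g v) \<longlongrightarrow> v) F}"
proof (rule closure_subset_eq[THEN iffD1])
  show "closure {v. ((\<lambda>g. L g v) \<longlongrightarrow> v) F} \<subseteq> {v. ((\<lambda>g. L g v) \<longlongrightarrow> v) F}"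
  proof
    fix v assume v: "v \<in> closure {v. ((\<lambda>g. L g v) \<longlongrightarrow> v) F}"
    have "((\<lambda>g. L g v) \<longlongrightarrow> v) F"
    proof (rule tendstoI)
      fix e :: real assume e: "0 < e"
      then obtain u where u: "((\<lambda>g. L g u) \<longlongrightarrow> u) F" "dist u v < e/3"
        using v unfolding closure_approachable by (metis divide_pos_pos mem_Collect_eq zero_less_numeral)
      have "\<forall>\<^sub>F g in F. dist (L g u) u < e/3" using u(1) e by (intro tendstoD) auto
      then show "\<forall>\<^sub>F g in F. dist (L g v) v < e"
      proof eventually_elim
        case (elim g)
        have "dist (L g v) v \<le> dist (L g v) (L g u) + dist (L g u) u + dist u v" by metric
        then show ?case using elim u(2) by (simp add: L dist_commute)
      qed
    qed
    then show "v \<in> {v. ((\<lambda>g. L g v) \<longlongrightarrow> v) F}" by simp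
  qed
qed

text \<open>Distances determine only combinations of total mass zero, hence the linear parts act on
  the differences \<open>\<tau> x\<close> from a base point. That \<open>0\<close> is a limit of
  points \<open>\<kappa> x\<close> ensures that these differences still span a dense subspace, and
  so that the affine hull of the points is dense.\<close>

lemma ex_strongly_moving_affine_action:
  fixes D :: "'g::topological_group_add \<times> nat \<Rightarrow> 'g \<times> nat \<Rightarrow> real" and \<kappa> :: "'g \<times> nat \<Rightarrow> 'b::banach"
  assumes D: "G_metric UNIV D" and \<epsilon>: "\<epsilon> > 0" and mv: "moves_finite UNIV D \<epsilon>"
    and W: "one_point_extendable W" and \<kappa>: "isometric_into UNIV D W \<kappa>"
    and zero: "0 \<in> closure (range \<kappa>)" and dense: "closure (span (range \<kappa>)) = UNIV"
  shows "\<exists>\<phi> :: 'g \<Rightarrow> 'b \<Rightarrow> 'b. continuous_isometric_action \<phi> \<and> (\<forall>g. affine_map (\<phi> g)) \<and> strongly_moving \<phi>"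
proof -
  have inv: "D (shift g x) (shift g y) = D x y" and lim_D: "((\<lambda>g. D (shift g x) x) \<longlongrightarrow> 0) (nhds 0)" for g x y
    using D unfolding G_metric_def by blast+
  have \<kappa>W: "\<kappa> x \<in> W" and dist_\<kappa>: "dist (\<kappa> x) (\<kappa> y) = D x y" for x y
    using \<kappa> unfolding isometric_into_def by blast+
  define x0 :: "'g \<times> nat" where "x0 = (0, 0)"
  define \<tau> where "\<tau> x = \<kappa> x - \<kappa> x0" for x
  have dense_\<tau>: "closure (span (range \<tau>)) = UNIV"
  proof -
    let ?S = "closure (span (range \<tau>))"
    have S: "subspace ?S" by (intro subspace_closure subspace_span)
    have \<tau>S: "\<tau> x \<in> ?S" for x using closure_subset span_base[of "\<tau> x" "range \<tau>"] by blast
    have "0 - \<kappa> x0 \<in> closure ((\<lambda>x. x - \<kappa> x0) ` range \<kappa>)"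
      unfolding closure_translation_subtract using zero by (rule imageI)
    also have "(\<lambda>x. x - \<kappa> x0) ` range \<kappa> = range \<tau>" by (auto simp: \<tau>_def)
    also have "closure (range \<tau>) \<subseteq> ?S" by (intro closure_mono) (rule span_superset)
    finally have "\<kappa> x0 \<in> ?S" using subspace_neg[OF S, of "- \<kappa> x0"] by simp
    then have "\<tau> x + \<kappa> x0 \<in> ?S" for x by (rule subspace_add[OF S \<tau>S])
    moreover have "\<tau> x + \<kappa> x0 = \<kappa> x" for x by (simp add: \<tau>_def)
    ultimately have "range \<kappa> \<subseteq> ?S" by auto
    then show ?thesis using closed_subspace_eq_UNIV[OF dense S closed_closure] by blast
  qed
  have "\<exists>L. linear L \<and> (\<forall>v. norm (L v) = norm v) \<and> (\<forall>x. L (\<tau> x) = \<kappa> (shift g x) - \<kappa> (shift g x0))" for g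
  proof (rule ex_linear_isometry[OF _ dense_\<tau>])
    show "norm (\<Sum>i\<in>I. c i *\<^sub>R \<tau> i) = norm (\<Sum>i\<in>I. c i *\<^sub>R (\<kappa> (shift g i) - \<kappa> (shift g x0)))"
      if "finite I" for I c
      unfolding \<tau>_def by (rule norm_sum_diff_determined_by_dist[OF W that]) (simp_all add: \<kappa>W dist_\<kappa> inv)
  qed
  then obtain L where lin: "\<And>g. linear (L g)" and norm_L: "\<And>g v. norm (L g v) = norm v"
    and L_\<tau>: "\<And>g x. L g (\<tau> x) = \<kappa> (shift g x) - \<kappa> (shift g x0)" by metis
  have L_diff: "L g (u - v) = L g u - L g v" for g u v using lin by (rule linear_diff)
  have dist_L: "dist (L g u) (L g v) = dist u v" for g u v by (simp add: dist_norm L_diff[symmetric] norm_L)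
  have cont_L: "continuous_on UNIV (L g)" for g
    unfolding continuous_on_iff by (auto simp: dist_L)
  have eqI: "f v = h v" if "linear f" "linear h" "continuous_on UNIV f" "continuous_on UNIV h" "\<And>x. f (\<tau> x) = h (\<tau> x)"
    for f h :: "'b \<Rightarrow> 'b" and v
  proof -
    have "subspace {v. f v = h v}"
      using that(1,2) by (intro subspaceI) (auto simp: linear_0 linear_add linear_scale)
    moreover have "closed {v. f v = h v}" using that(3,4) by (intro closed_Collect_eq)
    moreover have "range \<tau> \<subseteq> {v. f v = h v}" using that(5) by blast
    ultimately show ?thesis using closed_subspace_eq_UNIV[OF dense_\<tau>, of "{v. f v = h v}" v] by blast
  qed
  have L_add: "L (g + h) v = L g (L h v)" for g h v
  proof (rule eqI[of "L (g + h)" "\<lambda>v. L g (L h v)"])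
    have "linear (L g \<circ> L h)" by (intro linear_compose lin)
    then show "linear (\<lambda>v. L g (L h v))" by (simp add: comp_def)
    show "continuous_on UNIV (\<lambda>v. L g (L h v))"
      by (rule continuous_on_compose2[OF cont_L cont_L]) auto
    show "L (g + h) (\<tau> x) = L g (L h (\<tau> x))" for x
    proof -
      have "L h (\<tau> x) = \<tau> (shift h x) - \<tau> (shift h x0)" unfolding L_\<tau> by (simp add: \<tau>_def)
      then show ?thesis by (simp add: L_diff L_\<tau> shift_shift)
    qed
  qed (rule lin cont_L)+
  have L_zero: "L 0 v = v" for v
  proof (rule eqI[of "L 0" "\<lambda>v. v"])
    show "L 0 (\<tau> x) = \<tau> x" for x unfolding L_\<tau> by (simp add: \<tau>_def)
  qed (simp_all add: lin cont_L linear_ident)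
  have lim_\<kappa>: "((\<lambda>g. \<kappa> (shift g x)) \<longlongrightarrow> \<kappa> x) (nhds 0)" for x
    using lim_D by (subst tendsto_dist_iff) (simp add: dist_\<kappa>)
  have lim_L: "((\<lambda>g. L g v) \<longlongrightarrow> v) (nhds 0)" for v
  proof -
    have "subspace {v. ((\<lambda>g. L g v) \<longlongrightarrow> v) (nhds 0)}"
      by (intro subspaceI) (auto simp: linear_0[OF lin] linear_add[OF lin] linear_scale[OF lin] intro!: tendsto_intros)
    moreover
    have "\<tau> x \<in> {v. ((\<lambda>g. L g v) \<longlongrightarrow> v) (nhds 0)}" for x
      by (simp add: L_\<tau>) (simp add: \<tau>_def tendsto_diff lim_\<kappa>)
    then have "range \<tau> \<subseteq> {v. ((\<lambda>g. L g v) \<longlongrightarrow> v) (nhds 0)}" by blast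
    ultimately show ?thesis
      using closed_subspace_eq_UNIV[OF dense_\<tau> _ closed_convergence_set[of L, OF dist_L]] by blast
  qed
  \<comment> \<open>The affine map with linear part \<open>L g\<close> that sends each
    \<open>\<kappa> x\<close> to \<open>\<kappa> (shift g x)\<close>.\<close>
  define \<phi> where "\<phi> g v = L g (v - \<kappa> x0) + \<kappa> (shift g x0)" for g v
  have \<phi>_0: "\<phi> 0 v = v" for v by (simp add: \<phi>_def L_zero)
  have \<phi>_add: "\<phi> (g + h) v = \<phi> g (\<phi> h v)" for g h v
  proof -
    have "\<phi> g (\<phi> h v) = L g (L h (v - \<kappa> x0) + \<tau> (shift h x0)) + \<kappa> (shift g x0)"
      by (simp add: \<phi>_def \<tau>_def algebra_simps)
    then show ?thesis by (simp add: linear_add[OF lin] L_\<tau> shift_shift L_add \<phi>_def)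
  qed
  have dist_\<phi>: "dist (\<phi> g u) (\<phi> g v) = dist u v" for g u v
    using dist_L[of g "u - \<kappa> x0" "v - \<kappa> x0"] by (simp add: \<phi>_def dist_norm)
  have lim_\<phi>: "((\<lambda>g. \<phi> g v) \<longlongrightarrow> v) (nhds 0)" for v
    using tendsto_add[OF lim_L[of "v - \<kappa> x0"] lim_\<kappa>[of x0]] by (simp add: \<phi>_def)
  have act: "continuous_isometric_action \<phi>"
    unfolding continuous_isometric_action_def
  proof (intro conjI allI)
    show "isometry_onto UNIV dist UNIV dist (\<phi> g)" for g
    proof -
      have "\<phi> g (\<phi> (- g) v) = v" for v using \<phi>_add[of g "- g" v] \<phi>_0 by simp
      then have "surj (\<phi> g)" by (rule surjI)
      then show ?thesis by (simp add: isometry_onto_def isometric_embedding_def dist_\<phi>)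
    qed
    show "continuous_on UNIV (\<lambda>(g, v). \<phi> g v)"
      unfolding continuous_on_def
    proof (rule ballI)
      fix p :: "'g \<times> 'b"
      obtain g0 v0 where p: "p = (g0, v0)" by (cases p)
      have lim_g: "((\<lambda>g. \<phi> g v0) \<longlongrightarrow> \<phi> g0 v0) (nhds g0)"
      proof -
        have "((\<lambda>g. - g0 + g) \<longlongrightarrow> - g0 + g0) (nhds g0)" by (intro tendsto_intros filterlim_ident)
        then have "((\<lambda>g. \<phi> (- g0 + g) v0) \<longlongrightarrow> v0) (nhds g0)"
          using filterlim_compose[OF lim_\<phi>[of v0]] by simp
        then have "((\<lambda>g. dist (\<phi> g0 (\<phi> (- g0 + g) v0)) (\<phi> g0 v0)) \<longlongrightarrow> 0) (nhds g0)"
          by (simp only: dist_\<phi> tendsto_dist_iff[symmetric])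
        then show ?thesis by (subst tendsto_dist_iff) (simp add: \<phi>_add[symmetric])
      qed
      have "((\<lambda>q. dist (\<phi> (fst q) (snd q)) (\<phi> g0 v0)) \<longlongrightarrow> 0) (nhds (g0, v0))"
      proof (rule tendsto_sandwich[OF _ _ tendsto_const])
        show "\<forall>\<^sub>F q in nhds (g0, v0). 0 \<le> dist (\<phi> (fst q) (snd q)) (\<phi> g0 v0)" by simp
        have "dist (\<phi> g v) (\<phi> g0 v0) \<le> dist v v0 + dist (\<phi> g v0) (\<phi> g0 v0)" for g v
          using dist_triangle[of "\<phi> g v" "\<phi> g0 v0" "\<phi> g v0"] by (simp add: dist_\<phi>)
        then show "\<forall>\<^sub>F q in nhds (g0, v0). dist (\<phi> (fst q) (snd q)) (\<phi> g0 v0)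
            \<le> dist (snd q) v0 + dist (\<phi> (fst q) v0) (\<phi> g0 v0)" by simp
        have 1: "((\<lambda>q. dist (snd q) v0) \<longlongrightarrow> 0) (nhds (g0, v0))"
          unfolding tendsto_dist_iff[symmetric] nhds_prod by (rule filterlim_snd)
        have 2: "((\<lambda>q. dist (\<phi> (fst q) v0) (\<phi> g0 v0)) \<longlongrightarrow> 0) (nhds (g0, v0))"
          unfolding tendsto_dist_iff[symmetric] nhds_prod by (rule filterlim_compose[OF lim_g filterlim_fst])
        show "((\<lambda>q. dist (snd q) v0 + dist (\<phi> (fst q) v0) (\<phi> g0 v0)) \<longlongrightarrow> 0) (nhds (g0, v0))"
          using tendsto_add[OF 1 2] by simp
      qed
      then have "((\<lambda>q. \<phi> (fst q) (snd q)) \<longlongrightarrow> \<phi> g0 v0) (nhds (g0, v0))"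
        by (rule tendsto_dist_iff[THEN iffD2])
      then show "(\<lambda>(g, v). \<phi> g v) \<midarrow>p\<rightarrow> (case p of (g, v) \<Rightarrow> \<phi> g v)"
        unfolding tendsto_at_iff_tendsto_nhds by (simp add: p case_prod_unfold)
    qed
  qed (simp_all add: \<phi>_0 \<phi>_add)
  have aff: "affine_map (\<phi> g)" for g
    unfolding affine_map_def
    by (intro exI[of _ "L g"] exI[of _ "\<kappa> (shift g x0) - L g (\<kappa> x0)"]) (simp add: lin \<phi>_def L_diff)
  have \<phi>_sum: "\<phi> g (\<Sum>x\<in>Y. m x *\<^sub>R \<kappa> x) = (\<Sum>x\<in>Y. m x *\<^sub>R \<kappa> (shift g x))"
    if "(\<Sum>x\<in>Y. m x) = 1" for g Y m
  proof -
    have "(\<Sum>x\<in>Y. m x *\<^sub>R \<kappa> x) - \<kappa> x0 = (\<Sum>x\<in>Y. m x *\<^sub>R \<tau> x)"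
      using that by (simp add: \<tau>_def scaleR_diff_right sum_subtractf scaleR_sum_left[symmetric])
    then have "\<phi> g (\<Sum>x\<in>Y. m x *\<^sub>R \<kappa> x)
        = (\<Sum>x\<in>Y. m x *\<^sub>R (\<kappa> (shift g x) - \<kappa> (shift g x0))) + \<kappa> (shift g x0)"
      by (simp add: \<phi>_def linear_sum[OF lin] linear_scale[OF lin] L_\<tau>)
    also have "\<dots> = (\<Sum>x\<in>Y. m x *\<^sub>R \<kappa> (shift g x))"
      using that by (simp add: scaleR_diff_right sum_subtractf scaleR_sum_left[symmetric])
    finally show ?thesis .
  qed
  have far: "\<epsilon> \<le> dist (\<Sum>x\<in>Y. m x *\<^sub>R \<kappa> x) (\<Sum>x\<in>Y. m' x *\<^sub>R \<kappa> (shift g x))"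
    if Y: "finite Y" and m: "(\<Sum>x\<in>Y. m x) = 1" "(\<Sum>x\<in>Y. m' x) = 1"
      and g: "\<And>y y'. \<lbrakk>y \<in> Y; y' \<in> Y\<rbrakk> \<Longrightarrow> \<epsilon> \<le> D y (shift g y')" for Y m m' g
  proof -
    \<comment> \<open>The weights \<open>m\<close> on \<open>Y\<close> and \<open>- m'\<close> on
      its image have total mass zero. \<open>f i - f k\<close> is positive only for \<open>i\<close>
      in the first and \<open>k\<close> in the second copy of \<open>Y\<close>, where the choice of
      \<open>g\<close> provides the distance \<epsilon>.\<close>
    define c where "c = case_sum m (\<lambda>x. - m' x)"
    define z where "z = case_sum \<kappa> (\<lambda>x. \<kappa> (shift g x))"
    define f :: "'g \<times> nat + 'g \<times> nat \<Rightarrow> real" where "f = case_sum (\<lambda>_. \<epsilon>) (\<lambda>_. 0)"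
    have "(\<Sum>i\<in>Y <+> Y. c i * f i) \<le> norm (\<Sum>i\<in>Y <+> Y. c i *\<^sub>R z i)"
    proof (rule norm_sum_ge_Lipschitz_sum[OF W])
      show "finite (Y <+> Y)" using Y by simp
      show "(\<Sum>i\<in>Y <+> Y. c i) = 0" using Y m by (simp add: sum.Plus c_def sum_negf)
      show "z i \<in> W" for i by (cases i) (simp_all add: z_def \<kappa>W)
      show "f i - f k \<le> dist (z i) (z k)" if "i \<in> Y <+> Y" "k \<in> Y <+> Y" for i k
      proof (cases "\<exists>y y'. i = Inl y \<and> k = Inr y'")
        case True
        then show ?thesis using that g by (auto simp: f_def z_def dist_\<kappa>)
      next
        case False
        then have "f i - f k \<le> 0" using \<epsilon> by (cases i; cases k) (auto simp: f_def)
        then show ?thesis by (rule order_trans) simp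
      qed
    qed
    also have "(\<Sum>i\<in>Y <+> Y. c i * f i) = \<epsilon>"
      using Y m by (simp add: sum.Plus c_def f_def sum_distrib_right[symmetric])
    also have "(\<Sum>i\<in>Y <+> Y. c i *\<^sub>R z i) = (\<Sum>x\<in>Y. m x *\<^sub>R \<kappa> x) - (\<Sum>x\<in>Y. m' x *\<^sub>R \<kappa> (shift g x))"
      using Y by (simp add: sum.Plus c_def z_def sum_negf)
    finally show ?thesis by (simp add: dist_norm)
  qed
  have affine_dense: "closure (affine hull (range \<kappa>)) = UNIV"
  proof -
    have "affine hull (range \<kappa>) = (\<lambda>v. \<kappa> x0 + v) ` span ((\<lambda>v. - \<kappa> x0 + v) ` range \<kappa>)"
      by (rule affine_hull_span_gen) (simp add: hull_inc)
    also have "(\<lambda>v. - \<kappa> x0 + v) ` range \<kappa> = range \<tau>" by (auto simp: \<tau>_def)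
    finally show ?thesis by (simp add: closure_translation dense_\<tau>)
  qed
  have "strongly_moving \<phi>"
    unfolding strongly_moving_def
  \<comment> \<open>Each point of \<open>F\<close> is replaced by an affine combination within
    \<epsilon>/4; the two replacements cost half of the distance \<epsilon>.\<close>
  proof (intro exI[of _ "\<epsilon>/2"] conjI allI impI, goal_cases)
    case (2 F)
    have "\<exists>p. finite (fst p) \<and> fst p \<subseteq> range \<kappa> \<and> sum (snd p) (fst p) = 1 \<and>
        dist (\<Sum>s\<in>fst p. snd p s *\<^sub>R s) v < \<epsilon>/4" for v
    proof -
      have "v \<in> closure (affine hull (range \<kappa>))" by (simp add: affine_dense)
      then have "\<exists>a\<in>affine hull (range \<kappa>). dist a v < \<epsilon>/4"
        using \<epsilon> unfolding closure_approachable by (elim allE[of _ "\<epsilon>/4"]) simp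
      then obtain S u where "finite S" "S \<subseteq> range \<kappa>" "sum u S = 1" "dist (\<Sum>s\<in>S. u s *\<^sub>R s) v < \<epsilon>/4"
        unfolding affine_hull_explicit by blast
      then show ?thesis by (intro exI[of _ "(S, u)"]) simp
    qed
    then have "\<forall>v. \<exists>p. finite (fst p) \<and> fst p \<subseteq> range \<kappa> \<and> sum (snd p) (fst p) = 1 \<and>
        dist (\<Sum>s\<in>fst p. snd p s *\<^sub>R s) v < \<epsilon>/4" by (rule allI)
    from choice[OF this] obtain p where
      p: "\<forall>v. finite (fst (p v)) \<and> fst (p v) \<subseteq> range \<kappa> \<and> sum (snd (p v)) (fst (p v)) = 1 \<and>
        dist (\<Sum>s\<in>fst (p v). snd (p v) s *\<^sub>R s) v < \<epsilon>/4" ..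
    define S u where "S v = fst (p v)" and "u v = snd (p v)" for v
    have S: "finite (S v)" "S v \<subseteq> range \<kappa>" "sum (u v) (S v) = 1"
      and u: "dist (\<Sum>s\<in>S v. u v s *\<^sub>R s) v < \<epsilon>/4" for v
      using p by (simp_all add: S_def u_def)
    define P where "P = (\<Union>v\<in>F. S v)"
    have "finite P" "P \<subseteq> range \<kappa>" using 2 S by (auto simp: P_def)
    then obtain Y where Y: "inj_on \<kappa> Y" "P = \<kappa> ` Y" unfolding subset_image_inj by blast
    have finY: "finite Y" using \<open>finite P\<close> Y finite_image_iff by blast
    \<comment> \<open>All combinations are rewritten over the common support \<open>Y\<close>, since
      one \<open>g\<close> must serve all pairs of points of \<open>F\<close>.\<close>
    define m where "m v x = (if \<kappa> x \<in> S v then u v (\<kappa> x) else 0)" for v x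
    have m: "(\<Sum>x\<in>Y. m v x) = 1" "(\<Sum>x\<in>Y. m v x *\<^sub>R \<kappa> x) = (\<Sum>s\<in>S v. u v s *\<^sub>R s)" if v: "v \<in> F" for v
    proof -
      have SP: "S v \<subseteq> P" using v by (auto simp: P_def)
      have "(\<Sum>x\<in>Y. m v x) = (\<Sum>s\<in>P. if s \<in> S v then u v s else 0)"
        unfolding Y(2) sum.reindex[OF Y(1)] by (simp add: m_def)
      also have "\<dots> = sum (u v) (S v)"
        using SP \<open>finite P\<close> by (simp add: sum.If_cases Int_absorb1)
      finally show "(\<Sum>x\<in>Y. m v x) = 1" using S(3) by simp
      have "(\<Sum>x\<in>Y. m v x *\<^sub>R \<kappa> x) = (\<Sum>s\<in>P. if s \<in> S v then u v s *\<^sub>R s else 0)"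
        unfolding Y(2) sum.reindex[OF Y(1)] by (auto simp: m_def intro!: sum.cong)
      also have "\<dots> = (\<Sum>s\<in>S v. u v s *\<^sub>R s)"
        using SP \<open>finite P\<close> by (simp add: sum.If_cases Int_absorb1)
      finally show "(\<Sum>x\<in>Y. m v x *\<^sub>R \<kappa> x) = (\<Sum>s\<in>S v. u v s *\<^sub>R s)" .
    qed
    have "\<exists>g. \<forall>y\<in>Y. \<forall>y'\<in>Y. \<epsilon> \<le> D y (shift g y')"
      using mv finY by (simp add: moves_finite_def)
    then obtain g where g: "\<And>y y'. \<lbrakk>y \<in> Y; y' \<in> Y\<rbrakk> \<Longrightarrow> \<epsilon> \<le> D y (shift g y')" by blast
    have "\<epsilon>/2 \<le> setdist F (\<phi> g ` F)"
    proof (rule le_setdistI)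
      show "F \<noteq> {}" "\<phi> g ` F \<noteq> {}" using 2 by auto
      fix v w assume v: "v \<in> F" and "w \<in> \<phi> g ` F"
      then obtain v' where v': "v' \<in> F" "w = \<phi> g v'" by blast
      let ?a = "\<lambda>v. \<Sum>x\<in>Y. m v x *\<^sub>R \<kappa> x"
      have "\<epsilon> \<le> dist (?a v) (\<phi> g (?a v'))"
        unfolding \<phi>_sum[OF m(1)[OF v'(1)]] by (rule far[OF finY m(1)[OF v] m(1)[OF v'(1)] g])
      also have "\<dots> \<le> dist (?a v) v + dist v w + dist (?a v') v'"
        using dist_triangle[of "?a v" "\<phi> g (?a v')" v] dist_triangle[of v "\<phi> g (?a v')" w] v'(2)
          dist_\<phi>[of g v' "?a v'"] by (simp add: dist_commute)
      finally show "\<epsilon>/2 \<le> dist v w"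
        using u[of v] u[of v'] m(2)[OF v] m(2)[OF v'(1)] by simp
    qed
    then show ?case by blast
  qed (use \<epsilon> in simp)
  then show ?thesis using act aff by blast
qed

section \<open>Actions of precompact groups\<close>

text \<open>Zorn's lemma for inclusion yields maximal sets, so it is applied to complements. A chain
  has a nonempty intersection by compactness, because finitely many of its members contain a common
  member.\<close>

lemma ex_minimal_compact:
  fixes \<K> :: "'a::t2_space set set"
  assumes K0: "K0 \<in> \<K>" and cpt: "\<And>K. K \<in> \<K> \<Longrightarrow> compact K \<and> K \<noteq> {}"
    and Inter: "\<And>\<C>. \<lbrakk>\<C> \<noteq> {}; \<C> \<subseteq> \<K>; \<Inter>\<C> \<noteq> {}\<rbrakk> \<Longrightarrow> \<Inter>\<C> \<in> \<K>"
  shows "\<exists>K\<in>\<K>. \<forall>X\<in>\<K>. X \<subseteq> K \<longrightarrow> X = K"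
proof -
  have "\<exists>M\<in>uminus ` \<K>. \<forall>X\<in>uminus ` \<K>. M \<subseteq> X \<longrightarrow> X = M"
  proof (rule subset_Zorn)
    fix \<C> assume chain: "subset.chain (uminus ` \<K>) \<C>"
    define \<D> where "\<D> = uminus ` \<C>"
    have \<C>: "\<C> \<subseteq> uminus ` \<K>" "\<And>P Q. \<lbrakk>P \<in> \<C>; Q \<in> \<C>\<rbrakk> \<Longrightarrow> P \<subseteq> Q \<or> Q \<subseteq> P"
      using chain unfolding subset_chain_def by blast+
    have "\<D> \<subseteq> uminus ` uminus ` \<K>" unfolding \<D>_def using \<C>(1) by (rule image_mono)
    then have \<D>\<K>: "\<D> \<subseteq> \<K>" by (simp add: image_image)
    have lin: "X \<subseteq> Y \<or> Y \<subseteq> X" if XY: "X \<in> \<D>" "Y \<in> \<D>" for X Y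
    proof -
      obtain P Q where "P \<in> \<C>" "Q \<in> \<C>" "X = - P" "Y = - Q" using XY unfolding \<D>_def by blast
      then show ?thesis using \<C>(2)[of P Q] by simp blast
    qed
    show "\<exists>U\<in>uminus ` \<K>. \<forall>X\<in>\<C>. X \<subseteq> U"
    proof (cases "\<C> = {}")
      case True
      then show ?thesis using K0 by auto
    next
      case False
      then obtain K where K: "K \<in> \<D>" by (auto simp: \<D>_def)
      have "K \<inter> \<Inter>\<D> \<noteq> {}"
      proof (rule compact_imp_fip)
        show "compact K" using K \<D>\<K> cpt by blast
        show "closed T" if "T \<in> \<D>" for T using that \<D>\<K> cpt compact_imp_closed by blast
        fix \<F> assume \<F>: "finite \<F>" "\<F> \<subseteq> \<D>"
        have "\<exists>Y\<in>\<D>. Y \<subseteq> K \<inter> \<Inter>\<F>"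
          using \<F>
        proof (induction \<F> rule: finite_induct)
          case empty
          then show ?case using K by auto
        next
          case (insert X \<F>)
          then obtain Y where Y: "Y \<in> \<D>" "Y \<subseteq> K \<inter> \<Inter>\<F>" by auto
          have X: "X \<in> \<D>" using insert by simp
          show ?case
          proof (cases "X \<subseteq> Y")
            case True
            then show ?thesis using X Y by (intro bexI[of _ X]) auto
          next
            case False
            then have "Y \<subseteq> X" using lin[OF X Y(1)] by blast
            then show ?thesis using Y by (intro bexI[of _ Y]) auto
          qed
        qed
        then show "K \<inter> \<Inter>\<F> \<noteq> {}" using \<D>\<K> cpt by blast
      qed
      then have ne: "\<Inter>\<D> \<noteq> {}" by blast
      have "\<D> \<noteq> {}" using K by blast
      then have "\<Inter>\<D> \<in> \<K>" using \<D>\<K> ne by (rule Inter)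
      moreover have "X \<subseteq> - \<Inter>\<D>" if "X \<in> \<C>" for X
      proof -
        have "- X \<in> \<D>" using that by (simp add: \<D>_def)
        then show ?thesis by blast
      qed
      ultimately show ?thesis by blast
    qed
  qed
  then obtain M where M: "M \<in> uminus ` \<K>" "\<forall>X\<in>uminus ` \<K>. M \<subseteq> X \<longrightarrow> X = M" by blast
  then obtain K where K: "K \<in> \<K>" "M = - K" by blast
  show ?thesis
  proof (intro bexI[of _ K] ballI impI)
    fix X assume "X \<in> \<K>" "X \<subseteq> K"
    then have "- X = M" using M(2) K(2) by (intro M(2)[rule_format]) auto
    then show "X = K" using K(2) by simp
  qed (rule K(1))
qed

text \<open>Mazur's theorem: the convex hull of a finite net is compact, and its
  \<open>e/3\<close>-neighbourhood is convex, so it contains the convex hull of \<open>A\<close>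
  along with \<open>A\<close>.\<close>

lemma compact_closure_convex_hull:
  fixes A :: "'b::banach set"
  assumes tb: "\<And>e. e > 0 \<Longrightarrow> \<exists>F. finite F \<and> (\<forall>x\<in>A. \<exists>y\<in>F. dist x y < e)"
  shows "compact (closure (convex hull A))"
  unfolding compact_eq_totally_bounded
proof (intro conjI allI impI)
  show "complete (closure (convex hull A))" by (simp add: complete_eq_closed)
  fix e :: real assume e: "e > 0"
  then obtain F where F: "finite F" "\<And>x. x \<in> A \<Longrightarrow> \<exists>y\<in>F. dist x y < e/3"
    using tb[of "e/3"] by auto
  let ?H = "convex hull F"
  have "compact ?H" using F(1) by (rule finite_imp_compact_convex_hull)
  then have "\<exists>k. finite k \<and> ?H \<subseteq> (\<Union>x\<in>k. ball x (e/3))"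
    using e unfolding compact_eq_totally_bounded by (meson divide_pos_pos zero_less_numeral)
  then obtain k where k: "finite k" "?H \<subseteq> (\<Union>x\<in>k. ball x (e/3))" by blast
  let ?N = "\<Union>x\<in>?H. \<Union>y\<in>ball 0 (e/3). {x + y}"
  have "A \<subseteq> ?N"
  proof
    fix x assume "x \<in> A"
    then obtain y where y: "y \<in> F" "dist x y < e/3" using F(2) by blast
    have "y \<in> ?H" using y(1) by (rule hull_inc)
    moreover have "x - y \<in> ball 0 (e/3)" using y(2) by (simp add: dist_norm norm_minus_commute)
    moreover have "x \<in> {y + (x - y)}" by simp
    ultimately show "x \<in> ?N" by blast
  qed
  moreover have "convex ?N" by (intro convex_sums convex_convex_hull convex_ball)
  ultimately have hull: "convex hull A \<subseteq> ?N" by (rule hull_minimal)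
  have "closure (convex hull A) \<subseteq> (\<Union>x\<in>k. ball x e)"
  proof
    fix z assume "z \<in> closure (convex hull A)"
    then have "\<exists>x\<in>convex hull A. dist x z < e/3"
      using e unfolding closure_approachable by (elim allE[of _ "e/3"]) simp
    then obtain x where x: "x \<in> convex hull A" "dist x z < e/3" by blast
    then obtain h y where h: "h \<in> ?H" "norm y < e/3" "x = h + y" using hull by fastforce
    then obtain p where p: "p \<in> k" "dist p h < e/3" using k(2) by auto
    have "dist h x < e/3" using h by (simp add: dist_norm)
    then have "dist p z < e" using p(2) x(2) dist_triangle[of p z h] dist_triangle[of h z x] by simp
    then show "z \<in> (\<Union>x\<in>k. ball x e)" using p(1) by auto
  qed
  then show "\<exists>k. finite k \<and> closure (convex hull A) \<subseteq> (\<Union>x\<in>k. ball x e)" using k(1) by blast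
qed

text \<open>The barycentre of a finite \<open>diameter/2\<close>-net is not a diametral point.\<close>

lemma compact_convex_nondiametral:
  fixes K :: "'b::real_normed_vector set"
  assumes K: "compact K" "convex K" and ab: "a \<in> K" "b \<in> K" "a \<noteq> b"
  obtains u r where "u \<in> K" "r < diameter K" "\<And>x. x \<in> K \<Longrightarrow> dist u x \<le> r"
proof -
  define d where "d = diameter K"
  have bdd: "bounded K" using K(1) by (rule compact_imp_bounded)
  have le_d: "dist x y \<le> d" if "x \<in> K" "y \<in> K" for x y
    unfolding d_def using bdd that by (rule diameter_bounded_bound)
  have "0 < dist a b" using ab(3) by simp
  then have d: "0 < d" using le_d[OF ab(1,2)] by (rule less_le_trans)
  have cover: "K \<subseteq> (\<Union>x\<in>K. ball x (d/2))" using d by auto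
  obtain F where F: "F \<subseteq> K" "finite F" "K \<subseteq> (\<Union>x\<in>F. ball x (d/2))"
    by (rule compactE_image[OF K(1) _ cover]) (simp, rule that)
  have F_ne: "F \<noteq> {}" using F(3) ab(1) by auto
  define n where "n = real (card F)"
  have n: "0 < n" using F(2) F_ne by (simp add: n_def card_gt_0_iff)
  define u where "u = (\<Sum>x\<in>F. (1/n) *\<^sub>R x)"
  show ?thesis
  \<comment> \<open>Of the \<open>n\<close> net points one is within \<open>d/2\<close> of
    \<open>x\<close> and the others within \<open>d\<close>, and
    \<open>(d/2 + (n - 1) * d) / n\<close> is this radius.\<close>
  proof (rule that[of u "d - d / (2 * n)"])
    show "u \<in> K" unfolding u_def
      using F(2) n K(2) F(1) by (intro convex_sum) (auto simp: n_def)
    show "d - d / (2 * n) < diameter K" using d n by (simp add: d_def[symmetric])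
    fix x assume x: "x \<in> K"
    obtain p where p: "p \<in> F" "dist p x < d/2" using F(3) x by auto
    have "u - x = (\<Sum>y\<in>F. (1/n) *\<^sub>R (y - x))"
      using n by (simp add: u_def scaleR_diff_right sum_subtractf sum_constant_scaleR n_def)
    then have "norm (u - x) \<le> (\<Sum>y\<in>F. norm ((1/n) *\<^sub>R (y - x)))" by (simp only:) (rule norm_sum)
    also have "\<dots> = (\<Sum>y\<in>F. dist y x) / n" using n by (simp add: sum_divide_distrib dist_norm)
    also have "(\<Sum>y\<in>F. dist y x) = dist p x + (\<Sum>y\<in>F - {p}. dist y x)"
      using F(2) p(1) by (rule sum.remove)
    also have "(\<Sum>y\<in>F - {p}. dist y x) \<le> (\<Sum>y\<in>F - {p}. d)"
      using F(1) x by (intro sum_mono le_d) auto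
    also have "(\<Sum>y\<in>F - {p}. d) = (n - 1) * d"
      using F(2) p(1) n by (simp add: n_def of_nat_diff Suc_leI card_gt_0_iff F_ne)
    finally have "dist u x \<le> (dist p x + (n - 1) * d) / n" using n by (simp add: dist_norm divide_right_mono)
    also have "\<dots> \<le> (d/2 + (n - 1) * d) / n" using n p(2) by (intro divide_right_mono) auto
    also have "\<dots> = d - d / (2 * n)" using n by (simp add: field_simps)
    finally show "dist u x \<le> d - d / (2 * n)" .
  qed
qed

lemma affine_map_convex_combination:
  assumes "affine_map f" "s + t = 1"
  shows "f (s *\<^sub>R x + t *\<^sub>R y) = s *\<^sub>R f x + t *\<^sub>R f y"
proof -
  obtain L b where L: "linear L" "\<And>x. f x = L x + b" using assms(1) unfolding affine_map_def by blast
  have "b = s *\<^sub>R b + t *\<^sub>R b" using assms(2) by (simp add: scaleR_add_left[symmetric])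
  then show ?thesis
    by (simp add: L(2) linear_add[OF L(1)] linear_scale[OF L(1)] scaleR_add_right)
qed

text \<open>Kakutani's argument: a minimal compact convex invariant set has no two points, since the
  points of it within the radius of a non-diametral point form a smaller invariant set.\<close>

lemma Kakutani_fixed_point:
  fixes \<phi> :: "'g::group_add \<Rightarrow> 'b::real_normed_vector \<Rightarrow> 'b"
  assumes zero: "\<And>x. \<phi> 0 x = x" and add: "\<And>g h x. \<phi> (g + h) x = \<phi> g (\<phi> h x)"
    and iso: "\<And>g x y. dist (\<phi> g x) (\<phi> g y) = dist x y" and aff: "\<And>g. affine_map (\<phi> g)"
    and K0: "compact K0" "convex K0" "K0 \<noteq> {}" "\<And>g x. x \<in> K0 \<Longrightarrow> \<phi> g x \<in> K0"
  shows "\<exists>x. \<forall>g. \<phi> g x = x"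
proof -
  define \<K> where "\<K> = {K. compact K \<and> convex K \<and> K \<noteq> {} \<and> (\<forall>g. \<forall>x\<in>K. \<phi> g x \<in> K)}"
  have "\<exists>K\<in>\<K>. \<forall>X\<in>\<K>. X \<subseteq> K \<longrightarrow> X = K"
  proof (rule ex_minimal_compact)
    show "K0 \<in> \<K>" using K0 by (simp add: \<K>_def)
    show "compact K \<and> K \<noteq> {}" if "K \<in> \<K>" for K using that by (simp add: \<K>_def)
    fix \<C> assume \<C>: "\<C> \<noteq> {}" "\<C> \<subseteq> \<K>" "\<Inter>\<C> \<noteq> {}"
    obtain K where K: "K \<in> \<C>" using \<C>(1) by blast
    have "closed (\<Inter>\<C>)" using \<C>(2) by (intro closed_Inter) (auto simp: \<K>_def compact_imp_closed)
    then have "compact (K \<inter> \<Inter>\<C>)" using \<C>(2) K by (intro compact_Int_closed) (auto simp: \<K>_def)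
    moreover have "K \<inter> \<Inter>\<C> = \<Inter>\<C>" using K by blast
    ultimately have "compact (\<Inter>\<C>)" by simp
    moreover have "convex (\<Inter>\<C>)" using \<C>(2) by (intro convex_Inter) (auto simp: \<K>_def)
    ultimately show "\<Inter>\<C> \<in> \<K>" using \<C>(2,3) by (auto simp: \<K>_def)
  qed
  then obtain K where K: "K \<in> \<K>" and min: "\<And>X. \<lbrakk>X \<in> \<K>; X \<subseteq> K\<rbrakk> \<Longrightarrow> X = K" by blast
  have cpt: "compact K" and cvx: "convex K" and ne: "K \<noteq> {}" and inv: "\<And>g x. x \<in> K \<Longrightarrow> \<phi> g x \<in> K"
    using K by (simp_all add: \<K>_def)
  have single: "a = b" if ab: "a \<in> K" "b \<in> K" for a b
  proof (rule ccontr)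
    assume neq: "a \<noteq> b"
    obtain u r where u: "u \<in> K" "r < diameter K" "\<And>x. x \<in> K \<Longrightarrow> dist u x \<le> r"
      by (rule compact_convex_nondiametral[OF cpt cvx ab neq], rule that)
    define K' where "K' = K \<inter> (\<Inter>x\<in>K. cball x r)"
    have "K' \<in> \<K>"
      unfolding \<K>_def
    proof (intro CollectI conjI allI ballI)
      show "compact K'" unfolding K'_def using cpt by (intro compact_Int_closed closed_INT) auto
      show "convex K'" unfolding K'_def using cvx by (intro convex_Int convex_INT) auto
      show "K' \<noteq> {}" using u by (auto simp: K'_def dist_commute)
      fix g x assume x: "x \<in> K'"
      have "dist y (\<phi> g x) \<le> r" if "y \<in> K" for y
      proof -
        have "dist y (\<phi> g x) = dist (\<phi> (- g) y) (\<phi> (- g) (\<phi> g x))" by (simp add: iso)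
        also have "\<phi> (- g) (\<phi> g x) = x" by (simp add: add[symmetric] zero)
        finally show ?thesis using x inv[OF that] by (simp add: K'_def)
      qed
      then show "\<phi> g x \<in> K'" using x inv by (simp add: K'_def)
    qed
    then have "K' = K" by (rule min) (simp add: K'_def)
    have "dist x y \<le> r" if "x \<in> K" "y \<in> K" for x y
    proof -
      have "y \<in> K'" using that(2) \<open>K' = K\<close> by simp
      then show ?thesis using that(1) by (simp add: K'_def)
    qed
    then have "diameter K \<le> r" using ne by (intro diameter_le) (auto simp: dist_norm)
    then show False using u(2) by simp
  qed
  obtain x where "x \<in> K" using ne by blast
  then have "\<phi> g x = x" for g using single inv by blast
  then show ?thesis by blast
qed

text \<open>For \<open>g = a + v\<close> the distance from \<open>\<phi> g x\<close> to
  \<open>\<phi> a x\<close> equals that from \<open>\<phi> v x\<close> to \<open>x\<close>, which is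
  small for \<open>v\<close> near the identity; left translates are thus the right ones for
  covering.\<close>

lemma precompact_group_orbit:
  fixes \<phi> :: "'g::topological_group_add \<Rightarrow> 'x::metric_space \<Rightarrow> 'x"
  assumes G: "precompact_group TYPE('g)" and act: "continuous_isometric_action \<phi>" and e: "e > 0"
  shows "\<exists>F. finite F \<and> (\<forall>g. \<exists>a\<in>F. dist (\<phi> g x) (\<phi> a x) < e)"
proof -
  have zero: "\<phi> 0 x = x" and add: "\<And>g h. \<phi> (g + h) x = \<phi> g (\<phi> h x)"
    and cont: "continuous_on UNIV (\<lambda>(g, x). \<phi> g x)"
    using act unfolding continuous_isometric_action_def by blast+
  have iso: "dist (\<phi> g y) (\<phi> g z) = dist y z" for g y z
    using act by (simp add: continuous_isometric_action_def isometry_onto_def isometric_embedding_def)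
  have "continuous_on UNIV (\<lambda>g. (\<lambda>(g, x). \<phi> g x) (g, x))"
    by (rule continuous_on_compose2[OF cont]) (auto intro: continuous_intros)
  then have c: "continuous_on UNIV (\<lambda>g. \<phi> g x)" by simp
  define V where "V = {g. dist (\<phi> g x) x < e}"
  have "open V" unfolding V_def using c by (intro open_Collect_less continuous_intros)
  then have "0 \<in> interior V" using e by (simp add: interior_open V_def zero)
  with G[unfolded precompact_group_def, rule_format, of V]
  obtain F where F: "finite F" "(\<Union>a\<in>F. (\<lambda>v. a + v) ` V) = UNIV" by blast
  have "\<exists>a\<in>F. dist (\<phi> g x) (\<phi> a x) < e" for g
  proof -
    have "g \<in> (\<Union>a\<in>F. (\<lambda>v. a + v) ` V)" using F(2) by simp
    then obtain a v where av: "a \<in> F" "v \<in> V" "g = a + v" by blast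
    have "dist (\<phi> g x) (\<phi> a x) = dist (\<phi> v x) x" by (simp add: av(3) add iso)
    then have "dist (\<phi> g x) (\<phi> a x) < e" using av(2) by (simp add: V_def)
    then show ?thesis using av(1) by blast
  qed
  then show ?thesis using F(1) by blast
qed

text \<open>A finite \<epsilon>-net of an orbit, taken inside the orbit, cannot be moved: every
  \<open>g\<close> keeps its points in the orbit and hence within \<epsilon> of the net.\<close>

lemma precompact_group_not_strongly_moving:
  fixes \<phi> :: "'g::topological_group_add \<Rightarrow> 'x::metric_space \<Rightarrow> 'x"
  assumes G: "precompact_group TYPE('g)" and act: "continuous_isometric_action \<phi>"
  shows "\<not> strongly_moving \<phi>"
proof
  assume "strongly_moving \<phi>"
  then obtain \<epsilon> where \<epsilon>: "\<epsilon> > 0" "\<And>F. \<lbrakk>finite F; F \<noteq> {}\<rbrakk> \<Longrightarrow> \<exists>g. \<epsilon> \<le> setdist F (\<phi> g ` F)"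
    unfolding strongly_moving_def by blast
  fix x :: 'x
  obtain F where F: "finite F" "\<And>g. \<exists>a\<in>F. dist (\<phi> g x) (\<phi> a x) < \<epsilon>"
    using precompact_group_orbit[OF G act \<epsilon>(1), of x] by blast
  define P where "P = (\<lambda>a. \<phi> a x) ` F"
  obtain a where a: "a \<in> F" using F(2) by blast
  have "finite P" "P \<noteq> {}" using F(1) a by (auto simp: P_def)
  then obtain g where g: "\<epsilon> \<le> setdist P (\<phi> g ` P)" using \<epsilon>(2) by blast
  have add: "\<phi> (g + a) x = \<phi> g (\<phi> a x)"
    using act unfolding continuous_isometric_action_def by blast
  obtain b where b: "b \<in> F" "dist (\<phi> (g + a) x) (\<phi> b x) < \<epsilon>" using F(2) by blast
  have "setdist P (\<phi> g ` P) \<le> dist (\<phi> b x) (\<phi> g (\<phi> a x))"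
    using a b(1) by (intro setdist_le_dist) (auto simp: P_def)
  then show False using g b(2) by (simp add: add dist_commute)
qed

lemma precompact_group_fixed_point:
  fixes \<phi> :: "'g::topological_group_add \<Rightarrow> 'b::banach \<Rightarrow> 'b"
  assumes G: "precompact_group TYPE('g)" and act: "continuous_isometric_action \<phi>"
    and aff: "\<And>g. affine_map (\<phi> g)"
  shows "\<not> fixed_point_free \<phi>"
proof -
  have zero: "\<phi> 0 x = x" and add: "\<phi> (g + h) x = \<phi> g (\<phi> h x)" for g h x
    using act unfolding continuous_isometric_action_def by blast+
  have iso: "dist (\<phi> g y) (\<phi> g z) = dist y z" for g y z
    using act by (simp add: continuous_isometric_action_def isometry_onto_def isometric_embedding_def)
  have cont: "continuous_on UNIV (\<phi> g)" for g
    unfolding continuous_on_iff by (auto simp: iso)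
  define A where "A = range (\<lambda>g. \<phi> g 0)"
  define K where "K = closure (convex hull A)"
  have "\<exists>x. \<forall>g. \<phi> g x = x"
  proof (rule Kakutani_fixed_point[OF zero add iso aff])
    show "compact K"
      unfolding K_def
    proof (rule compact_closure_convex_hull)
      fix e :: real assume "e > 0"
      then obtain F where F: "finite F" "\<And>g. \<exists>a\<in>F. dist (\<phi> g 0) (\<phi> a 0) < e"
        using precompact_group_orbit[OF G act, of e 0] by blast
      then show "\<exists>F. finite F \<and> (\<forall>x\<in>A. \<exists>y\<in>F. dist x y < e)"
        by (intro exI[of _ "(\<lambda>a. \<phi> a 0) ` F"]) (auto simp: A_def)
    qed
    show "convex K" unfolding K_def by (intro convex_closure convex_convex_hull)
    have "A \<subseteq> K" unfolding K_def using closure_subset hull_subset by (rule order_trans[rotated])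
    then show "K \<noteq> {}" by (auto simp: A_def)
    fix g x assume x: "x \<in> K"
    \<comment> \<open>The preimage of \<open>K\<close> is closed, convex and contains the orbit, so
      it contains \<open>K\<close>.\<close>
    have "convex (\<phi> g -` K)"
      using \<open>convex K\<close> by (auto simp: convex_def affine_map_convex_combination[OF aff])
    moreover have "A \<subseteq> \<phi> g -` K"
    proof -
      have "\<phi> g ` A \<subseteq> A" by (auto simp: A_def add[symmetric])
      then show ?thesis using \<open>A \<subseteq> K\<close> by blast
    qed
    moreover have "closed (\<phi> g -` K)"
      using cont by (intro closed_vimage) (auto simp: K_def)
    ultimately have "K \<subseteq> \<phi> g -` K"
      unfolding K_def by (intro closure_minimal hull_minimal)
    then show "\<phi> g x \<in> K" using x by blast
  qed
  then show ?thesis by (simp add: fixed_point_free_def)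
qed

section \<open>Existence of strongly moving affine actions\<close>

text \<open>For fixed \<open>x\<close> the elements \<open>c\<close> with \<open>x\<close> in
  \<open>c + V\<close> form a nonempty open set, which meets every dense set.\<close>

lemma separable_imp_omega_bounded_group:
  assumes "separable_space (euclidean :: 'g::topological_group_add topology)"
  shows "omega_bounded_group TYPE('g)"
  unfolding omega_bounded_group_def
proof (intro allI impI, elim conjE)
  fix V :: "'g set" assume V: "open V" "V \<noteq> {}"
  obtain C :: "'g set" where C: "countable C" "closure C = UNIV"
    using assms unfolding separable_space_def by auto
  have "x \<in> (\<Union>a\<in>C. (\<lambda>v. a + v) ` V)" for x
  proof -
    have "open ((\<lambda>c. - c + x) -` V)" using V(1) by (intro open_vimage continuous_intros) auto
    moreover obtain v where "v \<in> V" using V(2) by blast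
    then have "x - v \<in> (\<lambda>c. - c + x) -` V" by simp
    ultimately have "(\<lambda>c. - c + x) -` V \<inter> C \<noteq> {}"
      using C(2) by (metis UNIV_I empty_iff open_Int_closure_eq_empty IntI)
    then obtain c where "c \<in> C" "- c + x \<in> V" by blast
    moreover have "x = c + (- c + x)" by simp
    ultimately show ?thesis by blast
  qed
  then show "\<exists>F. countable F \<and> (\<Union>a\<in>F. (\<lambda>v. a + v) ` V) = UNIV" using C(1) by blast
qed

lemma strongly_moving_imp_fixed_point_free:
  assumes "strongly_moving \<phi>"
  shows "fixed_point_free \<phi>"
  unfolding fixed_point_free_def
proof
  assume "\<exists>x. \<forall>g. \<phi> g x = x"
  then obtain x where x: "\<And>g. \<phi> g x = x" by blast
  obtain \<epsilon> where "\<epsilon> > 0" "\<exists>g. \<epsilon> \<le> setdist {x} (\<phi> g ` {x})"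
    using assms unfolding strongly_moving_def by (metis finite.emptyI finite.insertI insert_not_empty)
  then show False by (simp add: x)
qed

lemma Holmes_space_ex_action:
  fixes U :: "'u set" and \<iota> :: "'u \<Rightarrow> 'b::banach"
  assumes H: "holmes_space U d \<iota>" and G: "omega_bounded_group TYPE('g::topological_group_add)"
    and np: "\<not> precompact_group TYPE('g::topological_group_add)"
  shows "\<exists>\<phi> :: 'g \<Rightarrow> 'b \<Rightarrow> 'b. continuous_isometric_action \<phi> \<and> (\<forall>g. affine_map (\<phi> g)) \<and> strongly_moving \<phi>"
proof -
  have U: "urysohn_space U d" and \<iota>: "isometric_embedding U d UNIV dist \<iota>" and zero: "0 \<in> \<iota> ` U"
    and span: "closure (span (\<iota> ` U)) = UNIV"
    using H by (simp_all add: holmes_space_def)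
  have ne: "U \<noteq> {}" using zero by blast
  have W: "one_point_extendable (\<iota> ` U)" by (rule urysohn_space_one_point_extendable[OF U \<iota> ne])
  obtain u :: "nat \<Rightarrow> 'b" where u: "range u \<subseteq> \<iota> ` U" "\<iota> ` U \<subseteq> closure (range u)"
    by (rule urysohn_space_dense_sequence[OF U \<iota> ne])
  obtain D :: "'g \<times> nat \<Rightarrow> 'g \<times> nat \<Rightarrow> real" and \<epsilon> and \<kappa> :: "'g \<times> nat \<Rightarrow> 'b"
    where D: "G_metric UNIV D" "\<epsilon> > 0" "moves_finite UNIV D \<epsilon>" "isometric_into UNIV D (\<iota> ` U) \<kappa>"
      and dense: "\<iota> ` U \<subseteq> closure (range \<kappa>)"
    by (rule ex_G_metric_completing_to[OF G np W urysohn_space_complete[OF U \<iota>] u], rule that)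
  have "closure (span (range \<kappa>)) = UNIV"
  proof -
    have "\<iota> ` U \<subseteq> closure (span (range \<kappa>))"
      using dense closure_mono[OF span_superset] by (rule order_trans)
    then show ?thesis
      using closed_subspace_eq_UNIV[OF span subspace_closure[OF subspace_span] closed_closure] by blast
  qed
  moreover have "0 \<in> closure (range \<kappa>)" using zero dense by blast
  ultimately show ?thesis
    by (intro ex_strongly_moving_affine_action[OF D(1,2,3) W D(4)])
qed

theorem theorem6p1:
  fixes U :: "'u set" and d :: "'u \<Rightarrow> 'u \<Rightarrow> real" and \<iota> :: "'u \<Rightarrow> 'b::banach"
  assumes holmes: "holmes_space U d \<iota>"
    and G: "separable_space (euclidean :: 'g::{topological_group_add, t2_space} topology) \<or>
            omega_bounded_group TYPE('g)"
  shows "(\<not> precompact_group TYPE('g) \<longleftrightarrow>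
            (\<exists>\<phi> :: 'g \<Rightarrow> 'b \<Rightarrow> 'b. continuous_isometric_action \<phi> \<and>
               (\<forall>g. affine_map (\<phi> g)) \<and> fixed_point_free \<phi>)) \<and>
         (\<not> precompact_group TYPE('g) \<longleftrightarrow>
            (\<exists>\<phi> :: 'g \<Rightarrow> 'b \<Rightarrow> 'b. continuous_isometric_action \<phi> \<and> strongly_moving \<phi>))"
proof -
  have "omega_bounded_group TYPE('g)" using G separable_imp_omega_bounded_group by blast
  note ex = Holmes_space_ex_action[OF holmes this]
  show ?thesis
  proof (intro conjI iffI)
    assume "\<not> precompact_group TYPE('g)"
    from ex[OF this] obtain \<phi> :: "'g \<Rightarrow> 'b \<Rightarrow> 'b"
      where \<phi>: "continuous_isometric_action \<phi>" "\<forall>g. affine_map (\<phi> g)" "strongly_moving \<phi>" by blast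
    show "\<exists>\<phi> :: 'g \<Rightarrow> 'b \<Rightarrow> 'b. continuous_isometric_action \<phi> \<and> (\<forall>g. affine_map (\<phi> g)) \<and> fixed_point_free \<phi>"
      using \<phi> strongly_moving_imp_fixed_point_free by blast
    show "\<exists>\<phi> :: 'g \<Rightarrow> 'b \<Rightarrow> 'b. continuous_isometric_action \<phi> \<and> strongly_moving \<phi>" using \<phi> by blast
  next
    assume "\<exists>\<phi> :: 'g \<Rightarrow> 'b \<Rightarrow> 'b. continuous_isometric_action \<phi> \<and> (\<forall>g. affine_map (\<phi> g)) \<and> fixed_point_free \<phi>"
    then show "\<not> precompact_group TYPE('g)" using precompact_group_fixed_point by blast
  next
    assume "\<exists>\<phi> :: 'g \<Rightarrow> 'b \<Rightarrow> 'b. continuous_isometric_action \<phi> \<and> strongly_moving \<phi>"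
    then show "\<not> precompact_group TYPE('g)" using precompact_group_not_strongly_moving by blast
  qed
qed

end
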